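(* Let $d\ge 18$ be an integer and let $0<\theta<\theta_0$, where $\theta_0=\frac{p/18-1}{2p+4}$ and $p=\lfloor 17d/16\rfloor$. Then for every $\kappa\in(0,1)$ there exists $c_\kappa>0$ (independent of $N$) such that, on the domain $$\mathcal D:=\{z=E+i\eta\in\mathbb C:\ E\in(\kappa,4-\kappa)\text{ and }\eta\in(N^{-\theta},c_\kappa)\},$$ with high probability it holds that $$|m_N(z)-m_{\mathrm{MP}}(z)|\le \frac{N^{-\theta_0}}{\operatorname{Im}[z]}\qquad\text{for all } z\in\mathcal D .$$ That is, the probability that this inequality fails for some $z\in\mathcal D$ tends to $0$ as $N\to\infty$, for fixed $d,\theta,\kappa$.
   Context: Random matrix ensemble: let $\rho:\mathbb R/\mathbb Z\to[0,\infty)$ be a probability density on the $1$-torus with bounded derivative, $\|\rho'\|_\infty\le C$ ($\rho$ does not depend on $N$). For every $N\ge1$, let $\{\omega_{j,q}\}_{1\le j\le N,\,1\le q\le d}$ be independent random variables on $\mathbb R/\mathbb Z$, each with distribution $\rho(\omega)\,d\omega$. The $N\times N$ random matrix $X_N$ is defined by $[X_N]_{jk}=\frac1{\sqrt N}\exp\left(2\pi i\sum_{q=1}^d\omega_{j,q}k^q\right)$. Stieltjes transforms: for $z\in\mathbb C$ with $\operatorname{Im}[z]>0$, $m_N(z)=\frac1N\operatorname{tr}\left((X_NX_N^*-z)^{-1}\right)=\frac1N\sum_{j=1}^N\frac1{\sigma_j^2-z}$, where $\sigma_1,\dots,\sigma_N$ are the singular values of $X_N$; and $m_{\mathrm{MP}}(z)=\int_{\mathbb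 R}\frac{1}{x-z}\rho_{\mathrm{MP}}(x)\,dx$ with $\rho_{\mathrm{MP}}(x)=\frac1{2\pi x}\sqrt{x(4-x)}\,\mathbf 1_{0\le x\le4}$ (Marchenko-Pastur density). An estimate $A\le B$ holds with high probability if $\mathbb P(A>B)\to0$ as $N\to\infty$ for every fixed value of $d$. *)

theory Defs
  imports
    "HOL-Probability.Probability"
    "Jordan_Normal_Form.Schur_Decomposition"
    "Jordan_Normal_Form.Gauss_Jordan_Elimination"
begin

text \<open>Functions on the torus are 1-periodic functions on the reals.\<close>

definition torus_density :: "real \<Rightarrow> (real \<Rightarrow> real) \<Rightarrow> bool" where
  "torus_density C \<rho> \<longleftrightarrow>
     (\<forall>x. \<rho> (x + 1) = \<rho> x) \<and> (\<forall>x. 0 \<le> \<rho> x) \<and> (\<rho> has_integral 1) {0..1} \<and>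
     (\<forall>x. \<rho> differentiable (at x)) \<and> (\<forall>x. \<bar>deriv \<rho> x\<bar> \<le> C)"

text \<open>A torus-valued random variable is represented by its lift to the fundamental domain
  \<open>[0,1)\<close>; the matrix below only depends on the class modulo 1.\<close>

definition iid_torus_array ::
    "'a measure \<Rightarrow> (real \<Rightarrow> real) \<Rightarrow> nat \<Rightarrow> nat \<Rightarrow> (nat \<Rightarrow> nat \<Rightarrow> 'a \<Rightarrow> real) \<Rightarrow> bool" where
  "iid_torus_array M \<rho> N d \<omega> \<longleftrightarrow>
     prob_space.indep_vars M (\<lambda>_. borel) (\<lambda>(j, q). \<omega> j q) ({1..N} \<times> {1..d}) \<and>
     (\<forall>j\<in>{1..N}. \<forall>q\<in>{1..d}.
        distributed M lborel (\<omega> j q) (\<lambda>x. ennreal (\<rho> x * indicator {0..<1} x)))"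

text \<open>Matrix indices start at 0 in the library, whence the shifts by one.\<close>

definition X_mat :: "nat \<Rightarrow> nat \<Rightarrow> (nat \<Rightarrow> nat \<Rightarrow> real) \<Rightarrow> complex mat" where
  "X_mat N d w = Matrix.mat N N (\<lambda>(j, k).
     1 / complex_of_real (sqrt (real N)) *
     exp (2 * complex_of_real pi * \<i> *
       complex_of_real (\<Sum>q = 1..d. w (j + 1) q * real (k + 1) ^ q)))"

definition mat_trace :: "'a::comm_monoid_add mat \<Rightarrow> 'a" where
  "mat_trace A = (\<Sum>i<dim_row A. A $$ (i, i))"

text \<open>For \<open>Im z > 0\<close> the matrix to be inverted is invertible, so \<open>the\<close> is harmless.\<close>

definition m_emp :: "nat \<Rightarrow> nat \<Rightarrow> (nat \<Rightarrow> nat \<Rightarrow> real) \<Rightarrow> complex \<Rightarrow> complex" where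
  "m_emp N d w z =
     (let X = X_mat N d w
      in 1 / of_nat N * mat_trace (the (mat_inverse (X * mat_adjoint X - z \<cdot>\<^sub>m 1\<^sub>m N))))"

definition rho_MP :: "real \<Rightarrow> real" where
  "rho_MP x = 1 / (2 * pi * x) * sqrt (x * (4 - x)) * indicator {0..4} x"

definition m_MP :: "complex \<Rightarrow> complex" where
  "m_MP z = (LINT x|lborel. 1 / (complex_of_real x - z) * complex_of_real (rho_MP x))"

definition theta0 :: "nat \<Rightarrow> real" where
  "theta0 d = (let p = real_of_int \<lfloor>17 * real d / 16\<rfloor> in (p / 18 - 1) / (2 * p + 4))"

text \<open>This set is open and both transforms are continuous in \<open>z\<close>, so failure of a non-strict
  bound somewhere in it can be tested on a countable dense subset and is a measurable event.\<close>

definition spectral_domain :: "real \<Rightarrow> real \<Rightarrow> real \<Rightarrow> nat \<Rightarrow> complex set" where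
  "spectral_domain \<kappa> \<theta> c N =
     {z. Re z \<in> {\<kappa><..<4 - \<kappa>} \<and> Im z \<in> {real N powr (-\<theta>)<..<c}}"

end

theory Submission
  imports Defs "HOL-Real_Asymp.Real_Asymp"
begin

text \<open>
  Write \<open>x\<^sub>j\<close> for the rows of \<open>X\<close>, \<open>R = (X\<^sup>* X - z)\<^sup>-\<^sup>1\<close>, and \<open>R\<^sub>j\<close> for the same resolvent with
  the row \<open>x\<^sub>j\<close> replaced by \<open>0\<close>. The Sherman--Morrison formula gives, with \<open>q\<^sub>j = x\<^sub>j R\<^sub>j x\<^sub>j\<^sup>*\<close> and \<open>m = tr R / N\<close>,
  \<open>z m\<^sup>2 + z m + 1 = N\<^sup>-\<^sup>1 \<Sum>\<^sub>j (q\<^sub>j - m) / (1 + q\<^sub>j)\<close>. The transform \<open>m\<^sub>M\<^sub>P\<close> is a root of the left-hand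
  side, and in the bulk the other root stays away from the upper half plane, so that
  \<open>|m - m\<^sub>M\<^sub>P|\<close> is controlled by the average of the \<open>|q\<^sub>j - tr R\<^sub>j / N|\<close>.

  Conditionally on everything except \<open>\<omega>\<^sub>j\<^sub>1, \<omega>\<^sub>j\<^sub>2\<close>, the difference \<open>q\<^sub>j - tr R\<^sub>j / N\<close> is a trigonometric
  polynomial in these two variables with frequencies \<open>(k - l, k\<^sup>2 - l\<^sup>2)\<close>, \<open>k \<noteq> l\<close>. They are pairwise
  distinct, and a bounded density costs only a constant factor against the uniform one, so by
  orthogonality the second moment is at most a constant times
  \<open>N\<^sup>-\<^sup>2 |R\<^sub>j|\<^sup>2 \<le> 1 / (N \<eta>\<^sup>2)\<close> (Frobenius norm). At scale \<open>\<delta>\<close>, Chebyshev's inequality, a union bound over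
  a net of \<open>O(\<delta>\<^sup>-\<^sup>4)\<close> points and the Lipschitz continuity of the two transforms bound the probability
  of failure by \<open>O(N\<^sup>-\<^sup>1 \<delta>\<^sup>-\<^sup>8)\<close>; the scale \<open>\<delta> = N powr (- 1/36)\<close> is enough because \<open>\<theta>\<^sub>0 < 1/36\<close> for all \<open>d\<close>.
\<close>

unbundle no vec_syntax

subsection \<open>Complex vectors and matrices\<close>

lemma mat_adjoint_dim [simp]: "dim_row (mat_adjoint A) = dim_col A" "dim_col (mat_adjoint A) = dim_row A"
  by (auto simp: mat_adjoint_def)

lemma mat_adjoint_carrier [simp]: "A \<in> carrier_mat n m \<Longrightarrow> mat_adjoint A \<in> carrier_mat m n"
  by auto

lemma mat_adjoint_index [simp]:
  fixes A :: "complex mat"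
  shows "i < dim_col A \<Longrightarrow> j < dim_row A \<Longrightarrow> mat_adjoint A $$ (i, j) = cnj (A $$ (j, i))"
  by (simp add: mat_adjoint_def mat_of_rows_def conjugate_complex_def)

definition cnorm :: "complex Matrix.vec \<Rightarrow> real" where
  "cnorm v = L2_set (\<lambda>i. cmod (v $ i)) {..<dim_vec v}"

lemma cnorm_nonneg [simp]: "0 \<le> cnorm v"
  by (simp add: cnorm_def)

lemma cnorm_power2: "(cnorm v)\<^sup>2 = (\<Sum>i<dim_vec v. (cmod (v $ i))\<^sup>2)"
  by (simp add: cnorm_def L2_set_def sum_nonneg)

lemma cnorm_eqI: "(cnorm v)\<^sup>2 = r\<^sup>2 \<Longrightarrow> 0 \<le> r \<Longrightarrow> cnorm v = r"
  by (simp add: power2_eq_iff_nonneg)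

lemma cnorm_unit_vec [simp]: "k < n \<Longrightarrow> cnorm (unit_vec n k) = 1"
  by (rule cnorm_eqI) (simp_all add: cnorm_power2 if_distrib[of cmod] if_distrib[of "\<lambda>x. x\<^sup>2"] cong: if_cong)

lemma cscalar_prod_sum: "v \<bullet>c w = (\<Sum>i<dim_vec w. v $ i * cnj (w $ i))"
  by (simp add: scalar_prod_def lessThan_atLeast0 conjugate_complex_def)

lemma cscalar_prod_self: "v \<bullet>c v = complex_of_real ((cnorm v)\<^sup>2)"
  unfolding cscalar_prod_sum cnorm_power2 of_real_sum
  by (intro sum.cong refl complex_norm_square[symmetric])

lemma cscalar_prod_unit_vec: "k < n \<Longrightarrow> v \<bullet>c unit_vec n k = (v $ k :: complex)"
proof -
  assume "k < n"
  moreover have "conjugate (unit_vec n k) = (unit_vec n k :: complex Matrix.vec)"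
    by (rule eq_vecI) (auto simp: unit_vec_def)
  ultimately show ?thesis by simp
qed

lemma cnj_cscalar_prod: "v \<in> carrier_vec n \<Longrightarrow> w \<in> carrier_vec n \<Longrightarrow> cnj (v \<bullet>c w) = w \<bullet>c v"
  by (auto simp: cscalar_prod_sum mult.commute)

lemma cscalar_prod_Cauchy_Schwarz:
  assumes "dim_vec v = dim_vec w"
  shows "cmod (v \<bullet>c w) \<le> cnorm v * cnorm w"
proof -
  have "cmod (v \<bullet>c w) \<le> (\<Sum>i<dim_vec w. \<bar>cmod (v $ i)\<bar> * \<bar>cmod (w $ i)\<bar>)"
    unfolding cscalar_prod_sum by (rule order_trans[OF norm_sum]) (simp add: norm_mult)
  also have "\<dots> \<le> cnorm v * cnorm w"
    unfolding cnorm_def assms by (rule L2_set_mult_ineq)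
  finally show ?thesis .
qed

lemma mult_mat_vec_cscalar_prod:
  fixes A :: "complex mat"
  assumes "A \<in> carrier_mat n m" "v \<in> carrier_vec m" "w \<in> carrier_vec n"
  shows "(A *\<^sub>v v) \<bullet>c w = (\<Sum>i<n. \<Sum>k<m. A $$ (i, k) * v $ k * cnj (w $ i))"
  using assms unfolding cscalar_prod_sum
  by (auto simp: scalar_prod_def lessThan_atLeast0 sum_distrib_right)

lemma cscalar_prod_mat_adjoint:
  fixes A :: "complex mat"
  assumes A: "A \<in> carrier_mat n m" and v: "v \<in> carrier_vec m" and w: "w \<in> carrier_vec n"
  shows "(A *\<^sub>v v) \<bullet>c w = v \<bullet>c (mat_adjoint A *\<^sub>v w)"
proof -
  have "(A *\<^sub>v v) \<bullet>c w = (\<Sum>k<m. \<Sum>i<n. A $$ (i, k) * v $ k * cnj (w $ i))"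
    unfolding mult_mat_vec_cscalar_prod[OF assms] by (rule sum.swap)
  also have "\<dots> = v \<bullet>c (mat_adjoint A *\<^sub>v w)"
    using A v w unfolding cscalar_prod_sum
    by (auto simp: scalar_prod_def lessThan_atLeast0 sum_distrib_left intro!: sum.cong)
  finally show ?thesis .
qed

lemma mat_trace_sum: "A \<in> carrier_mat n n \<Longrightarrow> mat_trace A = (\<Sum>k<n. A $$ (k, k))"
  by (auto simp: mat_trace_def)

lemma mat_trace_eq_cscalar_prod:
  fixes A :: "complex mat"
  assumes "A \<in> carrier_mat n n"
  shows "mat_trace A = (\<Sum>k<n. (A *\<^sub>v unit_vec n k) \<bullet>c unit_vec n k)"
  using assms by (simp add: mat_trace_sum cscalar_prod_unit_vec)

lemma mat_trace_mult_commute: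
  fixes A B :: "'a :: comm_semiring_0 mat"
  assumes "A \<in> carrier_mat n m" "B \<in> carrier_mat m n"
  shows "mat_trace (A * B) = mat_trace (B * A)"
proof -
  have "mat_trace (A * B) = (\<Sum>i<n. \<Sum>k<m. A $$ (i, k) * B $$ (k, i))"
    using assms by (auto simp: mat_trace_def scalar_prod_def lessThan_atLeast0)
  also have "\<dots> = (\<Sum>k<m. \<Sum>i<n. A $$ (i, k) * B $$ (k, i))"
    by (rule sum.swap)
  also have "\<dots> = mat_trace (B * A)"
    using assms by (auto simp: mat_trace_def scalar_prod_def lessThan_atLeast0 mult.commute)
  finally show ?thesis .
qed

lemma mat_inverse_eqI:
  fixes A B :: "'a :: field mat"
  assumes A: "A \<in> carrier_mat n n" and B: "B \<in> carrier_mat n n" and AB: "A * B = 1\<^sub>m n"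
  shows "mat_inverse A = Some B"
proof -
  have BA: "B * A = 1\<^sub>m n" by (rule mat_mult_left_right_inverse[OF A B AB])
  then have "A \<in> Units (ring_mat TYPE('a) n ())"
    unfolding Units_def using A B AB by (auto simp: ring_mat_simps)
  then obtain C where C: "mat_inverse A = Some C"
    using mat_inverse(1)[OF A, where b = "()"] by (cases "mat_inverse A") auto
  then have AC: "A * C = 1\<^sub>m n" and C': "C \<in> carrier_mat n n"
    using mat_inverse(2)[OF A] by auto
  have "C = (B * A) * C" using BA C' by simp
  also have "\<dots> = B" unfolding assoc_mult_mat[OF B A C'] AC using B by simp
  finally show ?thesis using C by simp
qed

subsection \<open>Resolvents\<close>

text \<open>Cramer's rule is used as the definition because it makes the entries visibly measurable.\<close>

definition resolvent :: "complex mat \<Rightarrow> complex \<Rightarrow> complex mat" where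
  "resolvent A z = inverse (Determinant.det (char_matrix A z)) \<cdot>\<^sub>m adj_mat (char_matrix A z)"

lemma resolvent_carrier [simp]: "A \<in> carrier_mat n n \<Longrightarrow> resolvent A z \<in> carrier_mat n n"
  by (simp add: resolvent_def adj_mat)

lemma char_matrix_mult_vec:
  fixes A :: "complex mat"
  assumes A: "A \<in> carrier_mat n n" and v: "v \<in> carrier_vec n"
  shows "char_matrix A z *\<^sub>v v = A *\<^sub>v v - z \<cdot>\<^sub>v v"
  unfolding char_matrix_def using A v
  by (intro eq_vecI) (auto simp: add_scalar_prod_distrib[of _ n])

lemma
  assumes A: "A \<in> carrier_mat n n" and z: "\<not> eigenvalue A z"
  shows char_matrix_mult_resolvent: "char_matrix A z * resolvent A z = 1\<^sub>m n"
    and resolvent_mult_char_matrix: "resolvent A z * char_matrix A z = 1\<^sub>m n"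
proof -
  have B: "char_matrix A z \<in> carrier_mat n n" using A by simp
  have one: "inverse (Determinant.det (char_matrix A z)) \<cdot>\<^sub>m (Determinant.det (char_matrix A z) \<cdot>\<^sub>m 1\<^sub>m n) = 1\<^sub>m n"
    using z unfolding eigenvalue_det[OF A] by (intro eq_matI) auto
  show "char_matrix A z * resolvent A z = 1\<^sub>m n"
    unfolding resolvent_def mult_smult_distrib[OF B adj_mat(1)[OF B]] adj_mat(2)[OF B] by (rule one)
  show "resolvent A z * char_matrix A z = 1\<^sub>m n"
    unfolding resolvent_def mult_smult_assoc_mat[OF adj_mat(1)[OF B] B] adj_mat(3)[OF B] by (rule one)
qed

lemma
  assumes A: "A \<in> carrier_mat n n" and z: "\<not> eigenvalue A z"
  shows resolvent_mult_self: "resolvent A z * A = z \<cdot>\<^sub>m resolvent A z + 1\<^sub>m n"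
    and self_mult_resolvent: "A * resolvent A z = z \<cdot>\<^sub>m resolvent A z + 1\<^sub>m n"
proof -
  have R: "resolvent A z \<in> carrier_mat n n" and B: "char_matrix A z \<in> carrier_mat n n"
    and zI: "z \<cdot>\<^sub>m 1\<^sub>m n \<in> carrier_mat n n"
    using A by simp_all
  have A_eq: "A = z \<cdot>\<^sub>m 1\<^sub>m n + char_matrix A z"
    using A by (intro eq_matI) (auto simp: char_matrix_def)
  have "resolvent A z * (z \<cdot>\<^sub>m 1\<^sub>m n + char_matrix A z) = z \<cdot>\<^sub>m resolvent A z + 1\<^sub>m n"
    unfolding mult_add_distrib_mat[OF R zI B] mult_smult_distrib[OF R one_carrier_mat]
      resolvent_mult_char_matrix[OF assms] using R by simp
  then show "resolvent A z * A = z \<cdot>\<^sub>m resolvent A z + 1\<^sub>m n"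
    using A_eq by simp
  have "(z \<cdot>\<^sub>m 1\<^sub>m n + char_matrix A z) * resolvent A z = z \<cdot>\<^sub>m resolvent A z + 1\<^sub>m n"
    unfolding add_mult_distrib_mat[OF zI B R] mult_smult_assoc_mat[OF one_carrier_mat R]
      char_matrix_mult_resolvent[OF assms] using R by simp
  then show "A * resolvent A z = z \<cdot>\<^sub>m resolvent A z + 1\<^sub>m n"
    using A_eq by simp
qed

lemma
  assumes A: "A \<in> carrier_mat n n" and z: "\<not> eigenvalue A z" and w: "w \<in> carrier_vec n"
  shows resolvent_mult_shift_vec: "resolvent A z *\<^sub>v (A *\<^sub>v w - z \<cdot>\<^sub>v w) = w"
    and shift_mult_resolvent_vec: "A *\<^sub>v (resolvent A z *\<^sub>v w) - z \<cdot>\<^sub>v (resolvent A z *\<^sub>v w) = w"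
proof -
  have B: "char_matrix A z \<in> carrier_mat n n" and R: "resolvent A z \<in> carrier_mat n n"
    using A by simp_all
  have Rw: "resolvent A z *\<^sub>v w \<in> carrier_vec n" using R w by simp
  show "resolvent A z *\<^sub>v (A *\<^sub>v w - z \<cdot>\<^sub>v w) = w"
    unfolding char_matrix_mult_vec[OF A w, symmetric] assoc_mult_mat_vec[OF R B w, symmetric]
      resolvent_mult_char_matrix[OF A z] using w by simp
  show "A *\<^sub>v (resolvent A z *\<^sub>v w) - z \<cdot>\<^sub>v (resolvent A z *\<^sub>v w) = w"
    unfolding char_matrix_mult_vec[OF A Rw, symmetric] assoc_mult_mat_vec[OF B R w, symmetric]
      char_matrix_mult_resolvent[OF A z] using w by simp
qed

lemma resolvent_identity:
  assumes A: "A \<in> carrier_mat n n" and z: "\<not> eigenvalue A z"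
    and B: "B \<in> carrier_mat n n" and z': "\<not> eigenvalue B z'" and a: "a \<in> carrier_vec n"
  defines "w \<equiv> resolvent B z' *\<^sub>v a"
  shows "w = resolvent A z *\<^sub>v a + resolvent A z *\<^sub>v ((A *\<^sub>v w - B *\<^sub>v w) + (z' - z) \<cdot>\<^sub>v w)"
proof -
  have w: "w \<in> carrier_vec n" using a B unfolding w_def by (simp add: mult_mat_vec_carrier[of _ n n])
  have Aw: "A *\<^sub>v w \<in> carrier_vec n" and Bw: "B *\<^sub>v w \<in> carrier_vec n"
    using A B w by (simp_all add: mult_mat_vec_carrier[of _ n n])
  have "a = B *\<^sub>v w - z' \<cdot>\<^sub>v w"
    unfolding w_def using shift_mult_resolvent_vec[OF B z' a] by simp
  then have "A *\<^sub>v w - z \<cdot>\<^sub>v w = a + ((A *\<^sub>v w - B *\<^sub>v w) + (z' - z) \<cdot>\<^sub>v w)"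
    using A B w Aw Bw by (intro eq_vecI) (auto simp: algebra_simps simp del: index_mult_mat_vec)
  then have "w = resolvent A z *\<^sub>v (a + ((A *\<^sub>v w - B *\<^sub>v w) + (z' - z) \<cdot>\<^sub>v w))"
    using resolvent_mult_shift_vec[OF A z w] by simp
  also have "\<dots> = resolvent A z *\<^sub>v a + resolvent A z *\<^sub>v ((A *\<^sub>v w - B *\<^sub>v w) + (z' - z) \<cdot>\<^sub>v w)"
    using A a w Aw Bw by (intro mult_add_distrib_mat_vec[of _ n n]) auto
  finally show ?thesis .
qed

lemma resolvent_first_identity:
  assumes A: "A \<in> carrier_mat n n" and z: "\<not> eigenvalue A z" "\<not> eigenvalue A z'" and a: "a \<in> carrier_vec n"
  shows "resolvent A z' *\<^sub>v a =
    resolvent A z *\<^sub>v a + (z' - z) \<cdot>\<^sub>v (resolvent A z *\<^sub>v (resolvent A z' *\<^sub>v a))"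
proof -
  define w where "w = resolvent A z' *\<^sub>v a"
  have w: "w \<in> carrier_vec n" using A a unfolding w_def by (simp add: mult_mat_vec_carrier[of _ n n])
  have "A *\<^sub>v w \<in> carrier_vec n" using A w by simp
  then have "(A *\<^sub>v w - A *\<^sub>v w) + (z' - z) \<cdot>\<^sub>v w = (z' - z) \<cdot>\<^sub>v w" using w by simp
  then show ?thesis
    using resolvent_identity[OF A z(1) A z(2) a] mult_mat_vec[OF resolvent_carrier[OF A] w]
    by (simp add: w_def)
qed

subsection \<open>Resolvents of Hermitian matrices\<close>

definition hermitian_mat :: "nat \<Rightarrow> complex mat \<Rightarrow> bool" where
  "hermitian_mat n A \<longleftrightarrow> A \<in> carrier_mat n n \<and> mat_adjoint A = A"

lemma hermitian_mat_carrier: "hermitian_mat n A \<Longrightarrow> A \<in> carrier_mat n n"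
  by (simp add: hermitian_mat_def)

lemma hermitian_mat_Im_cscalar_prod:
  assumes A: "hermitian_mat n A" and v: "v \<in> carrier_vec n"
  shows "Im ((A *\<^sub>v v) \<bullet>c v) = 0"
proof -
  have Av: "A *\<^sub>v v \<in> carrier_vec n" using hermitian_mat_carrier[OF A] v by simp
  have "(A *\<^sub>v v) \<bullet>c v = v \<bullet>c (A *\<^sub>v v)"
    using cscalar_prod_mat_adjoint[OF hermitian_mat_carrier[OF A] v v] A by (simp add: hermitian_mat_def)
  then have "cnj ((A *\<^sub>v v) \<bullet>c v) = (A *\<^sub>v v) \<bullet>c v"
    using cnj_cscalar_prod[OF Av v] by simp
  then show ?thesis by (simp add: complex_eq_iff)
qed

lemma hermitian_mat_not_eigenvalue:
  assumes A: "hermitian_mat n A" and z: "Im z \<noteq> 0"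
  shows "\<not> eigenvalue A z"
proof
  assume "eigenvalue A z"
  then obtain v where v: "v \<in> carrier_vec n" "v \<noteq> 0\<^sub>v n" and Av: "A *\<^sub>v v = z \<cdot>\<^sub>v v"
    using hermitian_mat_carrier[OF A] by (auto simp: eigenvalue_def eigenvector_def)
  have "Im z * (cnorm v)\<^sup>2 = 0"
    using hermitian_mat_Im_cscalar_prod[OF A v(1)] v(1) unfolding Av by (simp add: cscalar_prod_self)
  then have "v \<bullet>c v = 0" using z by (simp add: cscalar_prod_self)
  then show False using v by simp
qed

lemma cscalar_prod_resolvent:
  assumes A: "hermitian_mat n A" and z: "Im z \<noteq> 0" and u: "u \<in> carrier_vec n"
  defines "v \<equiv> resolvent A z *\<^sub>v u"
  shows "v \<bullet>c u = complex_of_real (Re ((A *\<^sub>v v) \<bullet>c v)) - cnj z * complex_of_real ((cnorm v)\<^sup>2)"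
proof -
  note A' = hermitian_mat_carrier[OF A]
  have v: "v \<in> carrier_vec n" using A' u by (simp add: v_def mult_mat_vec_carrier[of _ n n])
  have Av: "A *\<^sub>v v \<in> carrier_vec n" using A' v by simp
  have "u = A *\<^sub>v v - z \<cdot>\<^sub>v v"
    unfolding v_def
    using shift_mult_resolvent_vec[OF A' hermitian_mat_not_eigenvalue[OF A z] u] by simp
  then have "u \<bullet>c v = (A *\<^sub>v v) \<bullet>c v - z * (v \<bullet>c v)"
    using v Av by (simp add: minus_scalar_prod_distrib[of _ n])
  also have "(A *\<^sub>v v) \<bullet>c v = complex_of_real (Re ((A *\<^sub>v v) \<bullet>c v))"
    using hermitian_mat_Im_cscalar_prod[OF A v] by (simp add: complex_eq_iff)
  finally have "cnj (u \<bullet>c v) = complex_of_real (Re ((A *\<^sub>v v) \<bullet>c v)) - cnj z * complex_of_real ((cnorm v)\<^sup>2)"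
    by (simp add: cscalar_prod_self)
  then show ?thesis unfolding cnj_cscalar_prod[OF u v] .
qed

lemma Im_cscalar_prod_resolvent:
  assumes A: "hermitian_mat n A" and z: "Im z \<noteq> 0" and u: "u \<in> carrier_vec n"
  shows "Im ((resolvent A z *\<^sub>v u) \<bullet>c u) = Im z * (cnorm (resolvent A z *\<^sub>v u))\<^sup>2"
  by (simp add: cscalar_prod_resolvent[OF assms])

lemma Im_mult_cscalar_prod_resolvent_nonneg:
  assumes A: "hermitian_mat n A" and z: "Im z > 0" and u: "u \<in> carrier_vec n"
    and pos: "\<And>v. v \<in> carrier_vec n \<Longrightarrow> 0 \<le> Re ((A *\<^sub>v v) \<bullet>c v)"
  shows "0 \<le> Im (z * ((resolvent A z *\<^sub>v u) \<bullet>c u))"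
proof -
  define v where "v = resolvent A z *\<^sub>v u"
  have v: "v \<in> carrier_vec n"
    using hermitian_mat_carrier[OF A] u by (simp add: v_def mult_mat_vec_carrier[of _ n n])
  have eq: "v \<bullet>c u = complex_of_real (Re ((A *\<^sub>v v) \<bullet>c v)) - cnj z * complex_of_real ((cnorm v)\<^sup>2)"
    unfolding v_def using z by (intro cscalar_prod_resolvent[OF A _ u]) simp
  show ?thesis
    unfolding v_def[symmetric] eq using z pos[OF v] by (simp add: algebra_simps)
qed

lemma cnorm_resolvent_le:
  assumes A: "hermitian_mat n A" and z: "Im z > 0" and u: "u \<in> carrier_vec n"
  shows "cnorm (resolvent A z *\<^sub>v u) \<le> cnorm u / Im z"
proof -
  define v where "v = resolvent A z *\<^sub>v u"
  have v: "v \<in> carrier_vec n"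
    using hermitian_mat_carrier[OF A] u by (simp add: v_def mult_mat_vec_carrier[of _ n n])
  have "Im z * (cnorm v)\<^sup>2 = Im (v \<bullet>c u)"
    unfolding v_def using z by (subst Im_cscalar_prod_resolvent[OF A _ u]) auto
  also have "\<dots> \<le> cnorm v * cnorm u"
    using abs_Im_le_cmod[of "v \<bullet>c u"] cscalar_prod_Cauchy_Schwarz[of v u] u v by auto
  finally have "cnorm v * (Im z * cnorm v) \<le> cnorm v * cnorm u"
    by (simp add: power2_eq_square mult_ac)
  then have "cnorm v = 0 \<or> Im z * cnorm v \<le> cnorm u"
    by (auto simp: mult_le_cancel_left less_le)
  then show ?thesis
    unfolding v_def[symmetric] using z by (auto simp: field_simps)
qed

lemma cnorm_resolvent_resolvent_le:
  assumes A: "hermitian_mat n A" and z: "Im z > 0" and B: "hermitian_mat n B" and z': "Im z' > 0"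
    and u: "u \<in> carrier_vec n"
  shows "cnorm (resolvent A z *\<^sub>v (resolvent B z' *\<^sub>v u)) \<le> cnorm u / (Im z * Im z')"
proof -
  have "resolvent B z' *\<^sub>v u \<in> carrier_vec n"
    using hermitian_mat_carrier[OF B] u by (simp add: mult_mat_vec_carrier[of _ n n])
  then have "cnorm (resolvent A z *\<^sub>v (resolvent B z' *\<^sub>v u)) \<le> cnorm (resolvent B z' *\<^sub>v u) / Im z"
    by (rule cnorm_resolvent_le[OF A z])
  also have "\<dots> \<le> (cnorm u / Im z') / Im z"
    using cnorm_resolvent_le[OF B z' u] z by (intro divide_right_mono) auto
  finally show ?thesis by (simp add: mult.commute)
qed

lemma Im_mat_trace_resolvent_nonneg:
  assumes A: "hermitian_mat n A" and z: "Im z > 0"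
  shows "0 \<le> Im (mat_trace (resolvent A z))"
  using z by (simp add: mat_trace_eq_cscalar_prod[OF resolvent_carrier[OF hermitian_mat_carrier[OF A]]]
      Im_cscalar_prod_resolvent[OF A] sum_nonneg)

lemma resolvent_Frobenius_le:
  assumes A: "hermitian_mat n A" and z: "Im z > 0"
  shows "(\<Sum>p\<in>{..<n} \<times> {..<n}. (cmod (resolvent A z $$ p))\<^sup>2) \<le> real n / (Im z)\<^sup>2"
proof -
  have R: "resolvent A z \<in> carrier_mat n n" using hermitian_mat_carrier[OF A] by simp
  have column: "(\<Sum>l<n. (cmod (resolvent A z $$ (l, k)))\<^sup>2) \<le> 1 / (Im z)\<^sup>2" if k: "k < n" for k
  proof -
    have "(\<Sum>l<n. (cmod (resolvent A z $$ (l, k)))\<^sup>2) = (cnorm (resolvent A z *\<^sub>v unit_vec n k))\<^sup>2"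
      using R k by (auto simp: cnorm_power2)
    also have "\<dots> \<le> (1 / Im z)\<^sup>2"
      using cnorm_resolvent_le[OF A z unit_vec_carrier, of k] k by (intro power_mono) auto
    finally show ?thesis by (simp add: power_divide)
  qed
  have "(\<Sum>p\<in>{..<n} \<times> {..<n}. (cmod (resolvent A z $$ p))\<^sup>2) =
      (\<Sum>k<n. \<Sum>l<n. (cmod (resolvent A z $$ (l, k)))\<^sup>2)"
    by (subst sum.swap) (simp add: sum.cartesian_product case_prod_unfold)
  also have "\<dots> \<le> (\<Sum>k<n. 1 / (Im z)\<^sup>2)"
    using column by (intro sum_mono) auto
  finally show ?thesis by simp
qed

lemma mat_trace_resolvent_Lipschitz:
  assumes A: "hermitian_mat n A" and z: "Im z > 0" and z': "Im z' > 0"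
  shows "cmod (mat_trace (resolvent A z) - mat_trace (resolvent A z'))
    \<le> real n * (cmod (z - z') / (Im z * Im z'))"
proof -
  note A' = hermitian_mat_carrier[OF A]
  let ?R = "resolvent A z" and ?R' = "resolvent A z'" and ?e = "unit_vec n"
  have R: "?R \<in> carrier_mat n n" and R': "?R' \<in> carrier_mat n n" using A' by simp_all
  have entry: "(?R' *\<^sub>v ?e k) \<bullet>c ?e k - (?R *\<^sub>v ?e k) \<bullet>c ?e k = (z' - z) * ((?R *\<^sub>v (?R' *\<^sub>v ?e k)) \<bullet>c ?e k)" for k
  proof -
    have carrier: "?R *\<^sub>v ?e k \<in> carrier_vec n" "?R *\<^sub>v (?R' *\<^sub>v ?e k) \<in> carrier_vec n"
      using R R' by (simp_all add: mult_mat_vec_carrier[of _ n n])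
    have "?R' *\<^sub>v ?e k = ?R *\<^sub>v ?e k + (z' - z) \<cdot>\<^sub>v (?R *\<^sub>v (?R' *\<^sub>v ?e k))"
      using z z' by (intro resolvent_first_identity[OF A'] hermitian_mat_not_eigenvalue[OF A]) auto
    then have "(?R' *\<^sub>v ?e k) \<bullet>c ?e k = (?R *\<^sub>v ?e k + (z' - z) \<cdot>\<^sub>v (?R *\<^sub>v (?R' *\<^sub>v ?e k))) \<bullet>c ?e k"
      by (rule arg_cong)
    also have "\<dots> = (?R *\<^sub>v ?e k) \<bullet>c ?e k + (z' - z) * ((?R *\<^sub>v (?R' *\<^sub>v ?e k)) \<bullet>c ?e k)"
      using carrier by (simp add: add_scalar_prod_distrib[of _ n])
    finally show ?thesis by simp
  qed
  have "cmod (mat_trace ?R - mat_trace ?R') = cmod (\<Sum>k<n. (z' - z) * ((?R *\<^sub>v (?R' *\<^sub>v ?e k)) \<bullet>c ?e k))"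
    unfolding mat_trace_eq_cscalar_prod[OF R] mat_trace_eq_cscalar_prod[OF R'] entry[symmetric]
    by (simp add: sum_subtractf norm_minus_commute)
  also have "\<dots> \<le> (\<Sum>k<n. cmod (z - z') / (Im z * Im z'))"
  proof (rule sum_norm_le)
    fix k assume "k \<in> {..<n}"
    then have "cmod ((?R *\<^sub>v (?R' *\<^sub>v ?e k)) \<bullet>c ?e k) \<le> 1 / (Im z * Im z')"
      using cscalar_prod_Cauchy_Schwarz[of "?R *\<^sub>v (?R' *\<^sub>v ?e k)" "?e k"] R
        cnorm_resolvent_resolvent_le[OF A z A z', of "?e k"] by simp
    from mult_left_mono[OF this, of "cmod (z - z')"]
    show "cmod ((z' - z) * ((?R *\<^sub>v (?R' *\<^sub>v ?e k)) \<bullet>c ?e k)) \<le> cmod (z - z') / (Im z * Im z')"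
      by (simp add: norm_mult norm_minus_commute)
  qed
  finally show ?thesis by simp
qed

subsection \<open>Rank-one updates\<close>

definition rank_one_update :: "nat \<Rightarrow> complex mat \<Rightarrow> complex mat \<Rightarrow> complex Matrix.vec \<Rightarrow> bool" where
  "rank_one_update n A B u \<longleftrightarrow> u \<in> carrier_vec n \<and>
     (\<forall>w\<in>carrier_vec n. A *\<^sub>v w = B *\<^sub>v w + (w \<bullet>c u) \<cdot>\<^sub>v u)"

lemma resolvent_rank_one_update:
  assumes A: "hermitian_mat n A" and B: "hermitian_mat n B" and u: "rank_one_update n A B u"
    and z: "Im z > 0" and a: "a \<in> carrier_vec n"
  defines "w \<equiv> resolvent B z *\<^sub>v a"
  shows "w = resolvent A z *\<^sub>v a + (w \<bullet>c u) \<cdot>\<^sub>v (resolvent A z *\<^sub>v u)"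
proof -
  note A' = hermitian_mat_carrier[OF A] and B' = hermitian_mat_carrier[OF B]
  have u': "u \<in> carrier_vec n" using u by (simp add: rank_one_update_def)
  have w: "w \<in> carrier_vec n" using B' a by (simp add: w_def mult_mat_vec_carrier[of _ n n])
  have Bw: "B *\<^sub>v w \<in> carrier_vec n" using B' w by simp
  have R: "resolvent A z \<in> carrier_mat n n" using A' by simp
  have "A *\<^sub>v w = B *\<^sub>v w + (w \<bullet>c u) \<cdot>\<^sub>v u"
    using u w by (simp add: rank_one_update_def)
  then have "(A *\<^sub>v w - B *\<^sub>v w) + (z - z) \<cdot>\<^sub>v w = (w \<bullet>c u) \<cdot>\<^sub>v u"
    using B' Bw u' w by (intro eq_vecI) (auto simp del: index_mult_mat_vec)
  moreover have "w = resolvent A z *\<^sub>v a + resolvent A z *\<^sub>v ((A *\<^sub>v w - B *\<^sub>v w) + (z - z) \<cdot>\<^sub>v w)"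
    unfolding w_def using z a
    by (intro resolvent_identity[OF A' _ B'] hermitian_mat_not_eigenvalue[OF A]
        hermitian_mat_not_eigenvalue[OF B]) auto
  ultimately show ?thesis using R u' by (simp add: mult_mat_vec)
qed

lemma Sherman_Morrison_cscalar_prod:
  assumes A: "hermitian_mat n A" and B: "hermitian_mat n B" and u: "rank_one_update n A B u" and z: "Im z > 0"
  defines "q \<equiv> (resolvent B z *\<^sub>v u) \<bullet>c u"
  shows "(1 + q) * ((resolvent A z *\<^sub>v u) \<bullet>c u) = q"
proof -
  have u': "u \<in> carrier_vec n" using u by (simp add: rank_one_update_def)
  have Ru: "resolvent A z *\<^sub>v u \<in> carrier_vec n"
    using hermitian_mat_carrier[OF A] u' by (simp add: mult_mat_vec_carrier[of _ n n])
  have "q = (resolvent A z *\<^sub>v u + q \<cdot>\<^sub>v (resolvent A z *\<^sub>v u)) \<bullet>c u"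
    unfolding q_def using resolvent_rank_one_update[OF A B u z u'] by (rule arg_cong)
  also have "\<dots> = (1 + q) * ((resolvent A z *\<^sub>v u) \<bullet>c u)"
    using Ru u' by (simp add: add_scalar_prod_distrib[of _ n] algebra_simps)
  finally show ?thesis by simp
qed

lemma mat_trace_resolvent_rank_one_update:
  assumes A: "hermitian_mat n A" and B: "hermitian_mat n B" and u: "rank_one_update n A B u" and z: "Im z > 0"
  shows "mat_trace (resolvent B z) - mat_trace (resolvent A z) =
    (resolvent B z *\<^sub>v (resolvent A z *\<^sub>v u)) \<bullet>c u"
proof -
  let ?RA = "resolvent A z" and ?RB = "resolvent B z" and ?e = "unit_vec n"
  have u': "u \<in> carrier_vec n" using u by (simp add: rank_one_update_def)
  have RA: "?RA \<in> carrier_mat n n" and RB: "?RB \<in> carrier_mat n n"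
    using hermitian_mat_carrier[OF A] hermitian_mat_carrier[OF B] by simp_all
  have v: "?RA *\<^sub>v u \<in> carrier_vec n" using RA u' by simp
  have entry: "(?RB *\<^sub>v ?e k) \<bullet>c ?e k - (?RA *\<^sub>v ?e k) \<bullet>c ?e k =
      (\<Sum>l<n. ?RB $$ (l, k) * (?RA *\<^sub>v u) $ k * cnj (u $ l))" if k: "k < n" for k
  proof -
    let ?w = "?RB *\<^sub>v ?e k"
    have "?w \<bullet>c ?e k = (?RA *\<^sub>v ?e k + (?w \<bullet>c u) \<cdot>\<^sub>v (?RA *\<^sub>v u)) \<bullet>c ?e k"
      using resolvent_rank_one_update[OF A B u z unit_vec_carrier] by (rule arg_cong)
    also have "\<dots> = (?RA *\<^sub>v ?e k) \<bullet>c ?e k + (?w \<bullet>c u) * (?RA *\<^sub>v u) $ k"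
      using carrier_matD[OF RA] k by (simp add: cscalar_prod_unit_vec del: index_mult_mat_vec)
    also have "?w \<bullet>c u = (\<Sum>l<n. ?RB $$ (l, k) * cnj (u $ l))"
      unfolding cscalar_prod_sum using u' RB k by simp
    finally show ?thesis by (simp add: sum_distrib_left mult_ac)
  qed
  have "mat_trace ?RB - mat_trace ?RA = (\<Sum>k<n. \<Sum>l<n. ?RB $$ (l, k) * (?RA *\<^sub>v u) $ k * cnj (u $ l))"
    unfolding mat_trace_eq_cscalar_prod[OF RA] mat_trace_eq_cscalar_prod[OF RB] sum_subtractf[symmetric]
    by (intro sum.cong refl entry) simp
  also have "\<dots> = (?RB *\<^sub>v (?RA *\<^sub>v u)) \<bullet>c u"
    unfolding mult_mat_vec_cscalar_prod[OF RB v u'] by (rule sum.swap)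
  finally show ?thesis .
qed

lemma cmod_mat_trace_resolvent_rank_one_update_le:
  assumes A: "hermitian_mat n A" and B: "hermitian_mat n B" and u: "rank_one_update n A B u" and z: "Im z > 0"
  shows "cmod (mat_trace (resolvent B z) - mat_trace (resolvent A z)) \<le> (cnorm u)\<^sup>2 / (Im z)\<^sup>2"
proof -
  have u': "u \<in> carrier_vec n" using u by (simp add: rank_one_update_def)
  have "cmod (mat_trace (resolvent B z) - mat_trace (resolvent A z)) \<le>
      cnorm (resolvent B z *\<^sub>v (resolvent A z *\<^sub>v u)) * cnorm u"
    unfolding mat_trace_resolvent_rank_one_update[OF assms]
    using u' carrier_matD[OF resolvent_carrier[OF hermitian_mat_carrier[OF B]]]
    by (intro cscalar_prod_Cauchy_Schwarz) simp
  also have "\<dots> \<le> cnorm u / (Im z * Im z) * cnorm u"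
    by (intro mult_right_mono cnorm_resolvent_resolvent_le[OF B z A z u']) simp
  finally show ?thesis by (simp add: power2_eq_square)
qed

subsection \<open>Gram matrices\<close>

definition gram :: "complex mat \<Rightarrow> complex mat" where
  "gram X = mat_adjoint X * X"

lemma gram_carrier [simp]: "X \<in> carrier_mat n m \<Longrightarrow> gram X \<in> carrier_mat m m"
  by (simp add: gram_def mult_carrier_mat[of _ m n])

lemma gram_index:
  assumes "X \<in> carrier_mat n m" "k < m" "l < m"
  shows "gram X $$ (k, l) = (\<Sum>j<n. cnj (X $$ (j, k)) * X $$ (j, l))"
  using assms by (auto simp: gram_def scalar_prod_def lessThan_atLeast0)

lemma hermitian_gram: "X \<in> carrier_mat n m \<Longrightarrow> hermitian_mat m (gram X)"
  unfolding hermitian_mat_def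
  by (auto simp: gram_index[of X n m] mult.commute carrier_matD[OF gram_carrier] intro!: eq_matI)

lemma gram_cscalar_prod:
  assumes X: "X \<in> carrier_mat n m" and v: "v \<in> carrier_vec m"
  shows "(gram X *\<^sub>v v) \<bullet>c v = complex_of_real ((cnorm (X *\<^sub>v v))\<^sup>2)"
proof -
  have Xv: "X *\<^sub>v v \<in> carrier_vec n" using X v by simp
  have Yw: "mat_adjoint X *\<^sub>v (X *\<^sub>v v) \<in> carrier_vec m"
    using X Xv by (simp add: mult_mat_vec_carrier[of _ m n])
  have real: "v \<bullet>c (mat_adjoint X *\<^sub>v (X *\<^sub>v v)) = complex_of_real ((cnorm (X *\<^sub>v v))\<^sup>2)"
    using cscalar_prod_mat_adjoint[OF X v Xv] by (simp add: cscalar_prod_self)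
  have "(gram X *\<^sub>v v) \<bullet>c v = (mat_adjoint X *\<^sub>v (X *\<^sub>v v)) \<bullet>c v"
    using X v by (simp add: gram_def assoc_mult_mat_vec[of _ m n])
  also have "\<dots> = cnj (v \<bullet>c (mat_adjoint X *\<^sub>v (X *\<^sub>v v)))"
    using cnj_cscalar_prod[OF v Yw] by simp
  also have "\<dots> = complex_of_real ((cnorm (X *\<^sub>v v))\<^sup>2)"
    unfolding real by simp
  finally show ?thesis .
qed

abbreviation adjoint_row :: "complex mat \<Rightarrow> nat \<Rightarrow> complex Matrix.vec" where
  "adjoint_row X j \<equiv> conjugate (Matrix.row X j)"

lemma adjoint_row_carrier: "X \<in> carrier_mat n m \<Longrightarrow> adjoint_row X j \<in> carrier_vec m"
  by auto

definition zero_row :: "complex mat \<Rightarrow> nat \<Rightarrow> complex mat" where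
  "zero_row X j = Matrix.mat (dim_row X) (dim_col X) (\<lambda>(i, k). if i = j then 0 else X $$ (i, k))"

lemma zero_row_carrier [simp]: "X \<in> carrier_mat n m \<Longrightarrow> zero_row X j \<in> carrier_mat n m"
  by (auto simp: zero_row_def)

lemma rank_one_update_gram:
  assumes X: "X \<in> carrier_mat n m" and j: "j < n"
  shows "rank_one_update m (gram X) (gram (zero_row X j)) (adjoint_row X j)"
  unfolding rank_one_update_def
proof (intro conjI ballI)
  show "adjoint_row X j \<in> carrier_vec m" using X by (rule adjoint_row_carrier)
  fix w :: "complex Matrix.vec" assume w: "w \<in> carrier_vec m"
  have dims: "dim_row X = n" "dim_col X = m" "dim_vec w = m" using X w by auto
  note gram_dims = carrier_matD[OF gram_carrier[OF X]] carrier_matD[OF gram_carrier[OF zero_row_carrier[OF X]]]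
  have entry: "gram X $$ (k, l) = gram (zero_row X j) $$ (k, l) + cnj (X $$ (j, k)) * X $$ (j, l)"
    if "k < m" "l < m" for k l
  proof -
    have "gram X $$ (k, l) = (\<Sum>i\<in>{..<n}-{j}. cnj (X $$ (i, k)) * X $$ (i, l)) + cnj (X $$ (j, k)) * X $$ (j, l)"
      unfolding gram_index[OF X that] using j by (subst sum.remove[of _ j]) auto
    also have "(\<Sum>i\<in>{..<n}-{j}. cnj (X $$ (i, k)) * X $$ (i, l)) = gram (zero_row X j) $$ (k, l)"
      unfolding gram_index[OF zero_row_carrier[OF X] that] using that dims
      by (intro sum.mono_neutral_cong_left) (auto simp: zero_row_def)
    finally show ?thesis .
  qed
  show "gram X *\<^sub>v w = gram (zero_row X j) *\<^sub>v w + (w \<bullet>c adjoint_row X j) \<cdot>\<^sub>v adjoint_row X j"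
    using j by (intro eq_vecI)
      (simp_all add: dims gram_dims scalar_prod_def entry conjugate_complex_def distrib_right sum.distrib
        sum_distrib_left sum_distrib_right algebra_simps)
qed

lemma mult_mult_adjoint_diag:
  assumes X: "X \<in> carrier_mat n m" and A: "A \<in> carrier_mat m m" and j: "j < n"
  shows "(X * (A * mat_adjoint X)) $$ (j, j) = (A *\<^sub>v adjoint_row X j) \<bullet>c adjoint_row X j"
proof -
  have carrier: "A *\<^sub>v adjoint_row X j \<in> carrier_vec m" "Matrix.row X j \<in> carrier_vec m"
    using A X adjoint_row_carrier[OF X] by auto
  have "col (mat_adjoint X) j = adjoint_row X j"
    using X j by (intro eq_vecI) (auto simp: conjugate_complex_def)
  then have "(X * (A * mat_adjoint X)) $$ (j, j) = Matrix.row X j \<bullet> (A *\<^sub>v adjoint_row X j)"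
    using X A j by (simp add: col_mult2[of _ m m _ n])
  also have "\<dots> = (A *\<^sub>v adjoint_row X j) \<bullet>c adjoint_row X j"
    using carrier by (simp add: comm_scalar_prod[of _ m])
  finally show ?thesis .
qed

lemma mult_resolvent_gram_mult_adjoint_carrier:
  assumes X: "X \<in> carrier_mat n m"
  shows "X * (resolvent (gram X) z * mat_adjoint X) \<in> carrier_mat n n"
  by (rule mult_carrier_mat[OF X
        mult_carrier_mat[OF resolvent_carrier[OF gram_carrier[OF X]] mat_adjoint_carrier[OF X]]])

lemma mat_trace_resolvent_gram:
  assumes X: "X \<in> carrier_mat n m" and z: "Im z > 0"
  defines "R \<equiv> resolvent (gram X) z"
  shows "z * mat_trace R + of_nat m = mat_trace (X * (R * mat_adjoint X))"
proof -
  note S = gram_carrier[OF X]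
  have R: "R \<in> carrier_mat m m" using S by (simp add: R_def)
  have "R * gram X = z \<cdot>\<^sub>m R + 1\<^sub>m m"
    unfolding R_def using z
    by (intro resolvent_mult_self[OF S] hermitian_mat_not_eigenvalue[OF hermitian_gram[OF X]]) simp
  then have "z * mat_trace R + of_nat m = mat_trace (R * gram X)"
    using R by (simp add: mat_trace_def sum.distrib sum_distrib_left)
  also have "R * gram X = (R * mat_adjoint X) * X"
    unfolding gram_def using R X by (simp add: assoc_mult_mat[of _ m m _ n _ m])
  also have "mat_trace \<dots> = mat_trace (X * (R * mat_adjoint X))"
    using R X by (intro mat_trace_mult_commute[of _ m n]) auto
  finally show ?thesis .
qed

lemma mat_trace_resolvent_gram_rows:
  assumes X: "X \<in> carrier_mat n m" and z: "Im z > 0"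
  shows "z * mat_trace (resolvent (gram X) z) + of_nat m =
    (\<Sum>j<n. (resolvent (gram X) z *\<^sub>v adjoint_row X j) \<bullet>c adjoint_row X j)"
  unfolding mat_trace_resolvent_gram[OF assms] mat_trace_sum[OF mult_resolvent_gram_mult_adjoint_carrier[OF X]]
  by (intro sum.cong refl mult_mult_adjoint_diag[OF X resolvent_carrier[OF gram_carrier[OF X]]]) simp

lemma mult_adjoint_mult_resolvent:
  assumes X: "X \<in> carrier_mat n m" and z: "Im z > 0"
  defines "W \<equiv> X * (resolvent (gram X) z * mat_adjoint X)"
  shows "(X * mat_adjoint X) * W = z \<cdot>\<^sub>m W + X * mat_adjoint X"
proof -
  define R Y where "R = resolvent (gram X) z" and "Y = mat_adjoint X"
  have W: "W = X * (R * Y)" by (simp add: W_def R_def Y_def)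
  have R: "R \<in> carrier_mat m m" and Y: "Y \<in> carrier_mat m n" using X by (simp_all add: R_def Y_def)
  note RY = mult_carrier_mat[OF R Y]
  have "gram X * R = z \<cdot>\<^sub>m R + 1\<^sub>m m"
    unfolding R_def using z
    by (intro self_mult_resolvent gram_carrier[OF X] hermitian_mat_not_eigenvalue[OF hermitian_gram[OF X]]) simp
  then have "(gram X * R) * Y = z \<cdot>\<^sub>m (R * Y) + Y"
    using R Y by (simp add: add_mult_distrib_mat[of _ m m] mult_smult_assoc_mat[of _ m m])
  moreover have "(X * Y) * W = X * ((gram X * R) * Y)"
    using X R Y RY unfolding W gram_def Y_def[symmetric]
    by (simp add: assoc_mult_mat[of _ n m _ n _ n] assoc_mult_mat[of _ m n _ m _ n]
        assoc_mult_mat[of _ m m _ m _ n])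
  ultimately have "(X * Y) * W = X * (z \<cdot>\<^sub>m (R * Y) + Y)" by simp
  also have "\<dots> = z \<cdot>\<^sub>m W + X * Y"
    unfolding W mult_add_distrib_mat[OF X smult_carrier_mat[OF RY] Y] mult_smult_distrib[OF X RY] ..
  finally show ?thesis by (simp add: Y_def)
qed

lemma mat_inverse_mult_adjoint_minus:
  assumes X: "X \<in> carrier_mat n m" and z: "Im z > 0"
  defines "W \<equiv> X * (resolvent (gram X) z * mat_adjoint X)"
  shows "mat_inverse (X * mat_adjoint X - z \<cdot>\<^sub>m 1\<^sub>m n) = Some ((1 / z) \<cdot>\<^sub>m (W - 1\<^sub>m n))"
proof -
  define G where "G = X * mat_adjoint X"
  have z0: "z \<noteq> 0" using z by auto
  have W: "W \<in> carrier_mat n n"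
    unfolding W_def by (rule mult_resolvent_gram_mult_adjoint_carrier[OF X])
  have G: "G \<in> carrier_mat n n" unfolding G_def by (rule mult_carrier_mat[OF X mat_adjoint_carrier[OF X]])
  have zI: "z \<cdot>\<^sub>m 1\<^sub>m n \<in> carrier_mat n n" and W1: "W - 1\<^sub>m n \<in> carrier_mat n n"
    and Gz: "G - z \<cdot>\<^sub>m 1\<^sub>m n \<in> carrier_mat n n"
    by (auto intro!: minus_carrier_mat)
  have "G * W = z \<cdot>\<^sub>m W + G"
    unfolding G_def W_def by (rule mult_adjoint_mult_resolvent[OF X z])
  then have "G * (W - 1\<^sub>m n) = z \<cdot>\<^sub>m W"
    unfolding mult_minus_distrib_mat[OF G W one_carrier_mat] right_mult_one_mat[OF G]
    using G W by (auto intro!: eq_matI)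
  then have "(G - z \<cdot>\<^sub>m 1\<^sub>m n) * (W - 1\<^sub>m n) = z \<cdot>\<^sub>m W - z \<cdot>\<^sub>m (W - 1\<^sub>m n)"
    unfolding minus_mult_distrib_mat[OF G zI W1] mult_smult_assoc_mat[OF one_carrier_mat W1] using W1 by simp
  also have "\<dots> = z \<cdot>\<^sub>m 1\<^sub>m n"
    using W by (auto intro!: eq_matI simp: algebra_simps)
  finally have "(G - z \<cdot>\<^sub>m 1\<^sub>m n) * ((1 / z) \<cdot>\<^sub>m (W - 1\<^sub>m n)) = (1 / z) \<cdot>\<^sub>m (z \<cdot>\<^sub>m 1\<^sub>m n)"
    unfolding mult_smult_distrib[OF Gz W1] by simp
  also have "\<dots> = 1\<^sub>m n" using z0 by (auto intro!: eq_matI)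
  finally show ?thesis
    unfolding G_def[symmetric] using Gz W1 by (intro mat_inverse_eqI[of _ n]) auto
qed

lemma mat_trace_mat_inverse_mult_adjoint_minus:
  assumes X: "X \<in> carrier_mat n m" and z: "Im z > 0"
  shows "z * mat_trace (the (mat_inverse (X * mat_adjoint X - z \<cdot>\<^sub>m 1\<^sub>m n))) + of_nat n =
    z * mat_trace (resolvent (gram X) z) + of_nat m"
proof -
  define W where "W = X * (resolvent (gram X) z * mat_adjoint X)"
  have z0: "z \<noteq> 0" using z by auto
  have W: "W \<in> carrier_mat n n"
    unfolding W_def by (rule mult_resolvent_gram_mult_adjoint_carrier[OF X])
  have "z * mat_trace ((1 / z) \<cdot>\<^sub>m (W - 1\<^sub>m n)) = mat_trace W - of_nat n"
    using W z0 by (simp add: mat_trace_def sum_distrib_left sum_subtractf)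
  then show ?thesis
    unfolding mat_inverse_mult_adjoint_minus[OF assms, folded W_def]
      mat_trace_resolvent_gram[OF assms, folded W_def] by simp
qed

subsection \<open>The self-consistent equation\<close>

definition mat_stieltjes :: "complex mat \<Rightarrow> complex \<Rightarrow> complex" where
  "mat_stieltjes A z = mat_trace (resolvent A z) / of_nat (dim_row A)"

definition MP_quadratic :: "complex \<Rightarrow> complex \<Rightarrow> complex" where
  "MP_quadratic z m = z * m\<^sup>2 + z * m + 1"

definition row_form :: "complex mat \<Rightarrow> complex \<Rightarrow> nat \<Rightarrow> complex" where
  "row_form X z j = (resolvent (gram (zero_row X j)) z *\<^sub>v adjoint_row X j) \<bullet>c adjoint_row X j"

definition row_dev :: "complex mat \<Rightarrow> complex \<Rightarrow> nat \<Rightarrow> complex" where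
  "row_dev X z j = row_form X z j - mat_stieltjes (gram (zero_row X j)) z"

lemma mat_stieltjes_gram:
  "X \<in> carrier_mat n m \<Longrightarrow> mat_stieltjes (gram X) z = mat_trace (resolvent (gram X) z) / of_nat m"
  by (simp add: mat_stieltjes_def gram_def)

lemma Im_mat_stieltjes_nonneg:
  assumes "hermitian_mat n A" "Im z > 0"
  shows "0 \<le> Im (mat_stieltjes A z)"
  using Im_mat_trace_resolvent_nonneg[OF assms] by (simp add: mat_stieltjes_def)

lemma mat_stieltjes_Lipschitz:
  assumes A: "hermitian_mat n A" and z: "Im z > 0" and z': "Im z' > 0"
  shows "cmod (mat_stieltjes A z - mat_stieltjes A z') \<le> cmod (z - z') / (Im z * Im z')"
proof -
  have n: "dim_row A = n" using hermitian_mat_carrier[OF A] by simp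
  have "cmod (mat_stieltjes A z - mat_stieltjes A z') =
      cmod (mat_trace (resolvent A z) - mat_trace (resolvent A z')) / real n"
    by (simp add: mat_stieltjes_def n diff_divide_distrib[symmetric] norm_divide)
  also have "\<dots> \<le> real n * (cmod (z - z') / (Im z * Im z')) / real n"
    by (intro divide_right_mono mat_trace_resolvent_Lipschitz[OF assms]) simp
  also have "\<dots> \<le> cmod (z - z') / (Im z * Im z')"
    using z z' by (cases "n = 0") auto
  finally show ?thesis .
qed

lemma mat_stieltjes_zero_row:
  assumes X: "X \<in> carrier_mat n m" and z: "Im z > 0" and j: "j < n"
  shows "cmod (mat_stieltjes (gram (zero_row X j)) z - mat_stieltjes (gram X) z)
    \<le> (cnorm (adjoint_row X j))\<^sup>2 / (real m * (Im z)\<^sup>2)"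
proof -
  note X' = zero_row_carrier[OF X]
  have "cmod (mat_stieltjes (gram (zero_row X j)) z - mat_stieltjes (gram X) z) =
      cmod (mat_trace (resolvent (gram (zero_row X j)) z) - mat_trace (resolvent (gram X) z)) / real m"
    by (simp add: mat_stieltjes_gram[OF X] mat_stieltjes_gram[OF X'] diff_divide_distrib[symmetric] norm_divide)
  also have "\<dots> \<le> (cnorm (adjoint_row X j))\<^sup>2 / (Im z)\<^sup>2 / real m"
    by (intro divide_right_mono hermitian_gram[OF X] hermitian_gram[OF X']
        cmod_mat_trace_resolvent_rank_one_update_le[OF _ _ rank_one_update_gram[OF X j] z]) simp
  finally show ?thesis by (simp add: mult.commute)
qed

lemma cmod_one_plus_row_form_ge:
  assumes X: "X \<in> carrier_mat n m" and z: "Im z > 0"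
  shows "Im z / cmod z \<le> cmod (1 + row_form X z j)"
proof -
  note X' = zero_row_carrier[OF X, of j]
  have "0 \<le> Im (z * row_form X z j)"
    unfolding row_form_def
    by (intro Im_mult_cscalar_prod_resolvent_nonneg[OF hermitian_gram[OF X'] z adjoint_row_carrier[OF X]])
      (simp add: gram_cscalar_prod[OF X'])
  then have "Im z \<le> Im (z * (1 + row_form X z j))"
    by (simp add: distrib_left)
  also have "\<dots> \<le> cmod z * cmod (1 + row_form X z j)"
    by (metis abs_Im_le_cmod abs_le_D1 norm_mult)
  finally show ?thesis using z by (cases "z = 0") (simp_all add: pos_divide_le_eq mult.commute)
qed

lemma one_plus_row_form_nonzero:
  assumes X: "X \<in> carrier_mat n m" and z: "Im z > 0"
  shows "1 + row_form X z j \<noteq> 0"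
proof -
  have "0 < Im z / cmod z" using z by (cases "z = 0") auto
  then show ?thesis using cmod_one_plus_row_form_ge[OF assms, of j] by auto
qed

lemma cscalar_prod_resolvent_gram_row:
  assumes X: "X \<in> carrier_mat n m" and z: "Im z > 0" and j: "j < n"
  shows "(resolvent (gram X) z *\<^sub>v adjoint_row X j) \<bullet>c adjoint_row X j = 1 - 1 / (1 + row_form X z j)"
  using Sherman_Morrison_cscalar_prod[OF hermitian_gram[OF X] hermitian_gram[OF zero_row_carrier[OF X]]
      rank_one_update_gram[OF X j] z, folded row_form_def] one_plus_row_form_nonzero[OF X z, of j]
  by (simp add: field_simps)

lemma MP_quadratic_mat_stieltjes:
  assumes X: "X \<in> carrier_mat n n" and z: "Im z > 0" and n: "n > 0"
  defines "m \<equiv> mat_stieltjes (gram X) z"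
  shows "MP_quadratic z m = (\<Sum>j<n. (row_form X z j - m) / (1 + row_form X z j)) / of_nat n"
proof -
  have zm: "z * m = - (\<Sum>j<n. 1 / (1 + row_form X z j)) / of_nat n"
  proof -
    have "z * mat_trace (resolvent (gram X) z) = - (\<Sum>j<n. 1 / (1 + row_form X z j))"
      using mat_trace_resolvent_gram_rows[OF X z] cscalar_prod_resolvent_gram_row[OF X z]
      by (simp add: sum_subtractf)
    then show ?thesis by (simp add: m_def mat_stieltjes_gram[OF X])
  qed
  have "(row_form X z j - m) / (1 + row_form X z j) = 1 - (1 + m) * (1 / (1 + row_form X z j))" for j
    using one_plus_row_form_nonzero[OF X z, of j] by (simp add: field_simps)
  then have "(\<Sum>j<n. (row_form X z j - m) / (1 + row_form X z j)) / of_nat n =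
      (of_nat n - (1 + m) * (\<Sum>j<n. 1 / (1 + row_form X z j))) / of_nat n"
    by (simp add: sum_subtractf sum_distrib_left)
  also have "\<dots> = 1 + (1 + m) * (z * m)"
    using n by (simp add: zm diff_divide_distrib)
  finally show ?thesis by (simp add: MP_quadratic_def algebra_simps power2_eq_square)
qed

lemma cmod_MP_quadratic_mat_stieltjes_le:
  assumes X: "X \<in> carrier_mat n n" and z: "Im z > 0" and n: "n > 0"
    and unit: "\<And>j. j < n \<Longrightarrow> cnorm (adjoint_row X j) = 1"
  shows "cmod (MP_quadratic z (mat_stieltjes (gram X) z)) \<le>
    cmod z / Im z * ((\<Sum>j<n. cmod (row_dev X z j)) / real n + 1 / (real n * (Im z)\<^sup>2))"
proof -
  define m where "m = mat_stieltjes (gram X) z"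
  define \<epsilon> where "\<epsilon> = 1 / (real n * (Im z)\<^sup>2)"
  have summand: "cmod ((row_form X z j - m) / (1 + row_form X z j)) \<le> cmod z / Im z * (cmod (row_dev X z j) + \<epsilon>)"
    if j: "j < n" for j
  proof -
    have "row_form X z j - m = row_dev X z j + (mat_stieltjes (gram (zero_row X j)) z - m)"
      by (simp add: row_dev_def)
    moreover have "cmod (mat_stieltjes (gram (zero_row X j)) z - m) \<le> \<epsilon>"
      using mat_stieltjes_zero_row[OF X z j] unit[OF j] by (simp add: m_def \<epsilon>_def)
    ultimately have "cmod (row_form X z j - m) \<le> cmod (row_dev X z j) + \<epsilon>"
      by (metis add_left_mono norm_triangle_ineq order_trans)
    moreover have "1 / cmod (1 + row_form X z j) \<le> 1 / (Im z / cmod z)"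
      using cmod_one_plus_row_form_ge[OF X z, of j] z by (intro frac_le) (auto intro!: divide_pos_pos)
    ultimately have "cmod (row_form X z j - m) * (1 / cmod (1 + row_form X z j)) \<le>
        (cmod (row_dev X z j) + \<epsilon>) * (cmod z / Im z)"
      by (intro mult_mono) (auto simp: \<epsilon>_def)
    then show ?thesis by (simp add: norm_divide mult.commute)
  qed
  have "cmod (MP_quadratic z m) \<le> (\<Sum>j<n. cmod z / Im z * (cmod (row_dev X z j) + \<epsilon>)) / real n"
    unfolding m_def MP_quadratic_mat_stieltjes[OF X z n] norm_divide norm_of_nat
    using summand unfolding m_def by (intro divide_right_mono sum_norm_le) auto
  also have "\<dots> = cmod z / Im z * ((\<Sum>j<n. cmod (row_dev X z j)) / real n + \<epsilon>)"
    unfolding sum_distrib_left[symmetric] sum.distrib using n by (simp add: field_simps)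
  finally show ?thesis by (simp add: m_def \<epsilon>_def)
qed

text \<open>The other root of the quadratic equation is \<open>-1 - m\<^sub>1\<close>, which lies in the lower half plane
  at distance at least \<open>Im m\<^sub>1\<close> from every point of the upper half plane.\<close>

lemma MP_quadratic_stability:
  assumes z: "z \<noteq> 0" and root: "MP_quadratic z m\<^sub>1 = 0" and im: "0 < Im m\<^sub>1" "0 \<le> Im m"
  shows "cmod (m - m\<^sub>1) \<le> cmod (MP_quadratic z m) / (Im m\<^sub>1 * cmod z)"
proof -
  have "z * ((m - m\<^sub>1) * (m + 1 + m\<^sub>1)) = MP_quadratic z m - MP_quadratic z m\<^sub>1"
    by (simp add: MP_quadratic_def algebra_simps power2_eq_square)
  then have factored: "cmod z * (cmod (m - m\<^sub>1) * cmod (m + 1 + m\<^sub>1)) = cmod (MP_quadratic z m)"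
    using root by (metis diff_zero norm_mult)
  have "Im m\<^sub>1 \<le> cmod (m + 1 + m\<^sub>1)"
    using im abs_Im_le_cmod[of "m + 1 + m\<^sub>1"] by simp
  then have "cmod z * (cmod (m - m\<^sub>1) * Im m\<^sub>1) \<le> cmod (MP_quadratic z m)"
    unfolding factored[symmetric] by (intro mult_left_mono) auto
  then show ?thesis using z im by (simp add: field_simps)
qed

lemma mat_stieltjes_near_MP_root:
  assumes X: "X \<in> carrier_mat n n" and z: "Im z > 0" and n: "n > 0"
    and unit: "\<And>j. j < n \<Longrightarrow> cnorm (adjoint_row X j) = 1"
    and root: "MP_quadratic z m\<^sub>1 = 0" and im: "0 < Im m\<^sub>1"
  shows "cmod (mat_stieltjes (gram X) z - m\<^sub>1) \<le>
    ((\<Sum>j<n. cmod (row_dev X z j)) / real n + 1 / (real n * (Im z)\<^sup>2)) / (Im m\<^sub>1 * Im z)"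
proof -
  let ?E = "(\<Sum>j<n. cmod (row_dev X z j)) / real n + 1 / (real n * (Im z)\<^sup>2)"
  have z0: "z \<noteq> 0" using z by auto
  have "cmod (mat_stieltjes (gram X) z - m\<^sub>1) \<le>
      cmod (MP_quadratic z (mat_stieltjes (gram X) z)) / (Im m\<^sub>1 * cmod z)"
    by (rule MP_quadratic_stability[OF z0 root im Im_mat_stieltjes_nonneg[OF hermitian_gram[OF X] z]])
  also have "\<dots> \<le> (cmod z / Im z * ?E) / (Im m\<^sub>1 * cmod z)"
    using cmod_MP_quadratic_mat_stieltjes_le[OF X z n unit] im by (intro divide_right_mono) auto
  also have "\<dots> = ?E / (Im m\<^sub>1 * Im z)"
    using z0 by simp
  finally show ?thesis .
qed

definition mean_sq_dev :: "complex mat \<Rightarrow> complex \<Rightarrow> real" where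
  "mean_sq_dev X z = (\<Sum>j<dim_row X. (cmod (row_dev X z j))\<^sup>2) / real (dim_row X)"

lemma mat_stieltjes_near_MP_root_mean_sq:
  assumes X: "X \<in> carrier_mat n n" and z: "Im z > 0" and n: "n > 0"
    and unit: "\<And>j. j < n \<Longrightarrow> cnorm (adjoint_row X j) = 1"
    and root: "MP_quadratic z m\<^sub>1 = 0" and im: "0 < Im m\<^sub>1"
  shows "cmod (mat_stieltjes (gram X) z - m\<^sub>1) \<le>
    (sqrt (mean_sq_dev X z) + 1 / (real n * (Im z)\<^sup>2)) / (Im m\<^sub>1 * Im z)"
proof -
  let ?Q = "\<lambda>j. cmod (row_dev X z j)"
  have "(\<Sum>j<n. ?Q j) / real n \<le> sqrt (mean_sq_dev X z)"
  proof (rule real_le_rsqrt)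
    have "(\<Sum>j<n. ?Q j)\<^sup>2 \<le> real n * (\<Sum>j<n. (?Q j)\<^sup>2)"
      using sum_squared_le_sum_of_squares[of ?Q "{..<n}"] by (simp add: mult.commute)
    then show "((\<Sum>j<n. ?Q j) / real n)\<^sup>2 \<le> mean_sq_dev X z"
      using n X by (simp add: mean_sq_dev_def power2_eq_square field_simps)
  qed
  then have "((\<Sum>j<n. ?Q j) / real n + 1 / (real n * (Im z)\<^sup>2)) / (Im m\<^sub>1 * Im z) \<le>
      (sqrt (mean_sq_dev X z) + 1 / (real n * (Im z)\<^sup>2)) / (Im m\<^sub>1 * Im z)"
    using z im by (intro divide_right_mono add_right_mono) auto
  with mat_stieltjes_near_MP_root[OF X z n unit root im] show ?thesis by (rule order_trans)
qed

subsection \<open>The random matrix\<close>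

definition phase :: "nat \<Rightarrow> (nat \<Rightarrow> nat \<Rightarrow> real) \<Rightarrow> nat \<Rightarrow> nat \<Rightarrow> real" where
  "phase d w j k = (\<Sum>q = 1..d. w (j + 1) q * real (k + 1) ^ q)"

lemma X_mat_carrier [simp]: "X_mat N d w \<in> carrier_mat N N"
  by (simp add: X_mat_def)

lemma X_mat_index:
  "j < N \<Longrightarrow> k < N \<Longrightarrow> X_mat N d w $$ (j, k) = of_real (1 / sqrt (real N)) * cis (2 * pi * phase d w j k)"
  by (simp add: X_mat_def phase_def cis_conv_exp mult_ac)

lemma cnorm_adjoint_row_X_mat: "j < N \<Longrightarrow> cnorm (adjoint_row (X_mat N d w) j) = 1"
proof (rule cnorm_eqI)
  assume j: "j < N"
  note dims = carrier_matD[OF X_mat_carrier[of N d w]]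
  have "(cnorm (adjoint_row (X_mat N d w) j))\<^sup>2 = (\<Sum>k<N. 1 / real N)"
    using j by (simp add: cnorm_power2 dims conjugate_complex_def X_mat_index norm_mult norm_divide power_divide)
  then show "(cnorm (adjoint_row (X_mat N d w) j))\<^sup>2 = 1\<^sup>2" using j by simp
qed simp

lemma m_emp_eq_mat_stieltjes:
  assumes z: "Im z > 0"
  shows "m_emp N d w z = mat_stieltjes (gram (X_mat N d w)) z"
proof -
  have "z * mat_trace (the (mat_inverse (X_mat N d w * mat_adjoint (X_mat N d w) - z \<cdot>\<^sub>m 1\<^sub>m N))) =
      z * mat_trace (resolvent (gram (X_mat N d w)) z)"
    using mat_trace_mat_inverse_mult_adjoint_minus[OF X_mat_carrier z] by simp
  moreover have "z \<noteq> 0" using z by auto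
  ultimately show ?thesis
    by (simp add: m_emp_def Let_def mat_stieltjes_gram[OF X_mat_carrier])
qed

lemma m_emp_Lipschitz:
  assumes "Im z > 0" "Im z' > 0"
  shows "cmod (m_emp N d w z - m_emp N d w z') \<le> cmod (z - z') / (Im z * Im z')"
  unfolding m_emp_eq_mat_stieltjes[OF assms(1)] m_emp_eq_mat_stieltjes[OF assms(2)]
  by (rule mat_stieltjes_Lipschitz[OF hermitian_gram[OF X_mat_carrier] assms])

subsection \<open>Stieltjes transforms of probability measures\<close>

definition stieltjes_transform :: "real measure \<Rightarrow> complex \<Rightarrow> complex" where
  "stieltjes_transform \<mu> z = (LINT x|\<mu>. 1 / (complex_of_real x - z))"

lemma cmod_inverse_of_real_minus_le:
  assumes "Im z > 0" shows "cmod (1 / (complex_of_real x - z)) \<le> 1 / Im z"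
  using assms abs_Im_le_cmod[of "complex_of_real x - z"] by (simp add: norm_divide frac_le)

context real_distribution
begin

lemma integrable_inverse_of_real_minus:
  assumes "Im z > 0"
  shows "integrable M (\<lambda>x. 1 / (complex_of_real x - z))"
  by (rule integrable_const_bound[of _ "1 / Im z"]) (use cmod_inverse_of_real_minus_le[OF assms] in auto)

lemma Im_stieltjes_transform_nonneg:
  assumes z: "Im z > 0"
  shows "0 \<le> Im (stieltjes_transform M z)"
proof -
  have "Im (stieltjes_transform M z) = (LINT x|M. Im (1 / (complex_of_real x - z)))"
    unfolding stieltjes_transform_def by (rule integral_Im[OF integrable_inverse_of_real_minus[OF z], symmetric])
  also have "\<dots> \<ge> 0"
    using z by (intro Bochner_Integration.integral_nonneg) (auto simp: Im_divide intro!: divide_nonneg_nonneg)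
  finally show ?thesis .
qed

lemma stieltjes_transform_Lipschitz:
  assumes z: "Im z > 0" and z': "Im z' > 0"
  shows "cmod (stieltjes_transform M z - stieltjes_transform M z') \<le> cmod (z - z') / (Im z * Im z')"
proof -
  let ?f = "\<lambda>z x. 1 / (complex_of_real x - z)"
  note int = integrable_inverse_of_real_minus[OF z] integrable_inverse_of_real_minus[OF z']
  have "stieltjes_transform M z - stieltjes_transform M z' = (LINT x|M. ?f z x - ?f z' x)"
    unfolding stieltjes_transform_def by (rule Bochner_Integration.integral_diff[OF int, symmetric])
  also have "cmod \<dots> \<le> (LINT x|M. cmod (z - z') / (Im z * Im z'))"
  proof (rule Bochner_Integration.integral_norm_bound_integral)
    show "integrable M (\<lambda>x. ?f z x - ?f z' x)" by (rule Bochner_Integration.integrable_diff[OF int])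
    fix x
    have "complex_of_real x - z \<noteq> 0" "complex_of_real x - z' \<noteq> 0"
      using z z' by (auto simp: complex_eq_iff)
    then have "?f z x - ?f z' x = (z - z') * (?f z x * ?f z' x)"
      by (simp add: field_simps)
    then have "norm (?f z x - ?f z' x) = cmod (z - z') * (cmod (?f z x) * cmod (?f z' x))"
      by (simp only: norm_mult)
    also have "\<dots> \<le> cmod (z - z') * (1 / Im z * (1 / Im z'))"
      using z z' by (intro mult_left_mono mult_mono cmod_inverse_of_real_minus_le) auto
    finally show "norm (?f z x - ?f z' x) \<le> cmod (z - z') / (Im z * Im z')" by simp
  qed simp
  also have "\<dots> = cmod (z - z') / (Im z * Im z')" using prob_space by simp
  finally show ?thesis .
qed

end

subsection \<open>The Marchenko--Pastur law\<close>

lemma rho_MP_nonneg: "0 \<le> rho_MP x"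
  by (cases "x = 0") (auto simp: rho_MP_def indicator_def)

lemma rho_MP_measurable [measurable]: "rho_MP \<in> borel_measurable borel"
  unfolding rho_MP_def by measurable

lemma has_vector_derivative_arccos_half:
  assumes x: "0 < x" "x < 4"
  shows "((\<lambda>x. arccos (x / 2 - 1)) has_vector_derivative - (1 / sqrt (x * (4 - x)))) (at x)"
proof -
  have "sqrt (1 - (x / 2 - 1)\<^sup>2) = sqrt (x * (4 - x) / 4)"
    by (rule arg_cong[of _ _ sqrt]) (simp add: field_simps power2_eq_square)
  also have "\<dots> = sqrt (x * (4 - x)) / 2" by (simp add: real_sqrt_divide)
  finally have "((\<lambda>x. arccos (x / 2 - 1)) has_real_derivative - (1 / sqrt (x * (4 - x)))) (at x)"
    using x by (auto intro!: derivative_eq_intros simp: inverse_eq_divide)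
  then show ?thesis by (simp add: has_real_derivative_iff_has_vector_derivative)
qed

text \<open>The substitution \<open>x = 2 + 2 cos t\<close> turns \<open>rho_MP x dx\<close> into \<open>(1 - cos t) / pi dt\<close> on \<open>[0, pi]\<close>.\<close>

lemma has_integral_rho_MP_scaleR:
  fixes g :: "real \<Rightarrow> 'a :: banach"
  assumes H: "\<And>t. (H has_vector_derivative ((1 - cos t) / pi) *\<^sub>R g (2 + 2 * cos t)) (at t)"
  shows "((\<lambda>x. rho_MP x *\<^sub>R g x) has_integral (H pi - H 0)) UNIV"
proof -
  let ?F = "\<lambda>x. - H (arccos (x / 2 - 1))"
  have "continuous_on UNIV H"
    by (intro continuous_at_imp_continuous_on ballI has_vector_derivative_continuous[OF H])
  moreover have "continuous_on {0..4} (\<lambda>x. arccos (x / 2 - 1))"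
    by (intro continuous_intros) auto
  ultimately have cont: "continuous_on {0..4} ?F"
    by (rule continuous_on_minus[OF continuous_on_compose2]) simp
  have "((\<lambda>x. rho_MP x *\<^sub>R g x) has_integral (?F 4 - ?F 0)) {0..4}"
  proof (rule fundamental_theorem_of_calculus_interior[OF _ cont])
    fix x :: real assume "x \<in> {0<..<4}"
    then have x: "0 < x" "x < 4" by auto
    have "sqrt (x * (4 - x)) * sqrt (x * (4 - x)) = x * (4 - x)" "sqrt (x * (4 - x)) \<noteq> 0"
      using x by auto
    then have rho: "rho_MP x = 1 / sqrt (x * (4 - x)) * ((4 - x) / (2 * pi))"
      using x by (simp add: rho_MP_def field_simps)
    have "(?F has_vector_derivative - ((- (1 / sqrt (x * (4 - x)))) *\<^sub>R ((1 - (x / 2 - 1)) / pi) *\<^sub>R g x)) (at x)"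
      using has_vector_derivative_minus[OF vector_diff_chain_at[OF has_vector_derivative_arccos_half[OF x] H]] x
      by (simp add: o_def)
    also have "- ((- (1 / sqrt (x * (4 - x)))) *\<^sub>R ((1 - (x / 2 - 1)) / pi) *\<^sub>R g x) = rho_MP x *\<^sub>R g x"
      unfolding rho by (simp add: field_simps)
    finally show "(?F has_vector_derivative rho_MP x *\<^sub>R g x) (at x)" .
  qed simp
  then have "((\<lambda>x. rho_MP x *\<^sub>R g x) has_integral (H pi - H 0)) {0..4}" by simp
  then show ?thesis
    by (rule has_integral_on_superset) (auto simp: rho_MP_def)
qed

lemma real_distribution_MP: "real_distribution (density lborel rho_MP)"
proof -
  have "((\<lambda>t. (t - sin t) / pi) has_vector_derivative ((1 - cos t) / pi) *\<^sub>R 1) (at t)" for t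
    unfolding has_real_derivative_iff_has_vector_derivative[symmetric]
    by (auto intro!: derivative_eq_intros)
  from has_integral_rho_MP_scaleR[OF this] have "(rho_MP has_integral 1) UNIV" by simp
  then have "(\<integral>\<^sup>+x. ennreal (rho_MP x) \<partial>lborel) = 1"
    using nn_integral_has_integral_lborel[OF rho_MP_measurable rho_MP_nonneg] by simp
  then have "prob_space (density lborel rho_MP)"
    by (intro prob_spaceI) (simp add: emeasure_density)
  then show ?thesis
    by (simp add: real_distribution_def real_distribution_axioms_def)
qed

interpretation MP: real_distribution "density lborel rho_MP"
  by (rule real_distribution_MP)

lemma m_MP_eq_stieltjes_transform: "m_MP z = stieltjes_transform (density lborel rho_MP) z"
  unfolding m_MP_def stieltjes_transform_def
  by (subst integral_density) (auto simp: rho_MP_nonneg scaleR_conv_of_real mult.commute)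

lemma joukowski_root:
  assumes z: "Im z > 0"
  obtains s :: complex where "s \<noteq> 0" "cmod s < 1" "z = 2 + s + 1 / s"
proof -
  define \<phi> where "\<phi> = Arccos (z / 2 - 1)"
  have cos: "cos \<phi> = z / 2 - 1" unfolding \<phi>_def by (rule cos_Arccos)
  have "exp (\<i> * \<phi>) + exp (- (\<i> * \<phi>)) = 2 * cos \<phi>" by (simp add: cos_exp_eq)
  then have exp: "z = 2 + exp (\<i> * \<phi>) + exp (- (\<i> * \<phi>))"
    by (simp add: cos add.assoc)
  have "Im \<phi> \<noteq> 0"
  proof
    assume "Im \<phi> = 0"
    then have "\<phi> = complex_of_real (Re \<phi>)" by (simp add: complex_eq_iff)
    then have "Im (cos \<phi>) = 0" by (metis Im_complex_of_real cos_of_real)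
    then show False using z by (simp add: cos)
  qed
  then consider "0 < Im \<phi>" | "0 < Im (- \<phi>)" by fastforce
  then show ?thesis
  proof cases
    case 1
    then show ?thesis
      using exp by (intro that[of "exp (\<i> * \<phi>)"]) (auto simp: exp_minus inverse_eq_divide)
  next
    case 2
    moreover have "1 / exp (- (\<i> * \<phi>)) = exp (\<i> * \<phi>)" by (simp add: exp_minus inverse_eq_divide)
    ultimately show ?thesis
      using exp by (intro that[of "exp (- (\<i> * \<phi>))"]) auto
  qed
qed

definition poisson_primitive :: "complex \<Rightarrow> real \<Rightarrow> complex" where
  "poisson_primitive s t = complex_of_real t + \<i> * Ln (1 - s * cis t) - \<i> * Ln (1 - s * cis (- t))"

lemma one_minus_not_nonpos_Reals:
  assumes "cmod s < 1" "cmod w = 1"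
  shows "1 - s * w \<notin> \<real>\<^sub>\<le>\<^sub>0"
proof -
  have "Re (s * w) < 1"
    using assms complex_Re_le_cmod[of "s * w"] by (simp add: norm_mult)
  then show ?thesis by (auto simp: complex_nonpos_Reals_iff)
qed

lemma has_vector_derivative_Ln_one_minus_cis:
  assumes s: "cmod s < 1"
  shows "((\<lambda>t. Ln (1 - s * cis (r * t))) has_vector_derivative
    - (\<i> * of_real r) * (s * cis (r * t) / (1 - s * cis (r * t)))) (at t)"
proof -
  have "((\<lambda>t. cis (r * t)) has_vector_derivative r *\<^sub>R (\<i> * cis (r * t))) (at t)"
    unfolding has_vector_derivative_def by (auto intro!: derivative_eq_intros simp: mult.commute)
  moreover have "((\<lambda>w. Ln (1 - s * w)) has_field_derivative - s / (1 - s * cis (r * t))) (at (cis (r * t)))"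
    using one_minus_not_nonpos_Reals[OF s, of "cis (r * t)"]
    by (auto intro!: derivative_eq_intros simp: inverse_eq_divide)
  ultimately have "((\<lambda>w. Ln (1 - s * w)) \<circ> (\<lambda>t. cis (r * t)) has_vector_derivative
      r *\<^sub>R (\<i> * cis (r * t)) * (- s / (1 - s * cis (r * t)))) (at t)"
    by (rule field_vector_diff_chain_at)
  then show ?thesis by (simp add: o_def scaleR_conv_of_real mult_ac)
qed

lemma has_vector_derivative_poisson_primitive:
  assumes s: "cmod s < 1"
  shows "(poisson_primitive s has_vector_derivative
    (1 - s\<^sup>2) / (1 - 2 * s * of_real (cos t) + s\<^sup>2)) (at t)"
proof -
  define v w where "v = cis t" and "w = cis (- t)"
  have nz: "1 - s * v \<noteq> 0" "1 - s * w \<noteq> 0"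
    using one_minus_not_nonpos_Reals[OF s, of v] one_minus_not_nonpos_Reals[OF s, of w]
    by (auto simp: v_def w_def)
  have vw: "v * w = 1" by (simp add: v_def w_def cis_mult)
  have "v + w = 2 * of_real (cos t)" by (simp add: v_def w_def complex_eq_iff)
  moreover have "(1 - s * v) * (1 - s * w) = 1 - s * (v + w) + s\<^sup>2 * (v * w)"
    by (simp add: algebra_simps power2_eq_square)
  ultimately have denominator: "1 - 2 * s * of_real (cos t) + s\<^sup>2 = (1 - s * v) * (1 - s * w)"
    by (simp add: vw mult_ac)
  have "1 + s * v / (1 - s * v) + s * w / (1 - s * w) = (1 - s\<^sup>2 * (v * w)) / ((1 - s * v) * (1 - s * w))"
    using nz by (simp add: divide_simps) (simp add: algebra_simps power2_eq_square)
  then have kernel: "1 + s * v / (1 - s * v) + s * w / (1 - s * w) =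
      (1 - s\<^sup>2) / (1 - 2 * s * of_real (cos t) + s\<^sup>2)"
    by (simp add: denominator vw)
  have "((\<lambda>t. complex_of_real t + \<i> * Ln (1 - s * cis (1 * t)) - \<i> * Ln (1 - s * cis (- 1 * t)))
      has_vector_derivative 1 + \<i> * (- (\<i> * of_real 1) * (s * cis (1 * t) / (1 - s * cis (1 * t))))
        - \<i> * (- (\<i> * of_real (- 1)) * (s * cis (- 1 * t) / (1 - s * cis (- 1 * t))))) (at t)"
    by (intro has_vector_derivative_add has_vector_derivative_diff has_vector_derivative_mult_right
        has_vector_derivative_Ln_one_minus_cis[OF s])
      (auto intro!: derivative_eq_intros)
  then show ?thesis
    unfolding kernel[symmetric] poisson_primitive_def[abs_def] v_def w_def by simp
qed

lemma has_vector_derivative_m_MP_primitive: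
  assumes s: "s \<noteq> 0" "cmod s < 1" and z: "z = 2 + s + 1 / s" and im: "Im z > 0"
  shows "((\<lambda>t. ((1 - s) / (1 + s) * poisson_primitive s t - of_real t) / (2 * of_real pi)) has_vector_derivative
    ((1 - cos t) / pi) *\<^sub>R (1 / (complex_of_real (2 + 2 * cos t) - z))) (at t)"
proof -
  define D where "D = 1 - 2 * s * of_real (cos t) + s\<^sup>2"
  have s1: "1 + s \<noteq> 0" using s by (metis add_eq_0_iff norm_minus_cancel norm_one less_irrefl)
  have z_D: "of_real (2 + 2 * cos t) - z = - (D / s)"
    using s by (simp add: z D_def field_simps power2_eq_square)
  have "of_real (2 + 2 * cos t) - z \<noteq> 0" using im by (auto simp: complex_eq_iff)
  then have D: "D \<noteq> 0" unfolding z_D by auto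
  have "((\<lambda>t. ((1 - s) / (1 + s) * poisson_primitive s t - of_real t) / (2 * of_real pi)) has_vector_derivative
      ((1 - s) / (1 + s) * ((1 - s\<^sup>2) / D) - 1) / (2 * of_real pi)) (at t)"
    unfolding D_def
    by (intro has_vector_derivative_divide has_vector_derivative_diff has_vector_derivative_mult_right
        has_vector_derivative_poisson_primitive[OF s(2)]) (auto intro!: derivative_eq_intros)
  moreover have "(1 - s) / (1 + s) * ((1 - s\<^sup>2) / D) - 1 = - (2 * s * of_real (1 - cos t)) / D"
  proof -
    have "(1 - s) / (1 + s) * ((1 - s\<^sup>2) / D) = ((1 + s) * (1 - s)\<^sup>2) / ((1 + s) * D)"
      by (simp add: algebra_simps power2_eq_square)
    also have "\<dots> - 1 = ((1 - s)\<^sup>2 - D) / D"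
      using D s1 by (simp add: diff_divide_distrib)
    also have "(1 - s)\<^sup>2 - D = - (2 * s * of_real (1 - cos t))"
      by (simp add: D_def algebra_simps power2_eq_square)
    finally show ?thesis .
  qed
  moreover have "- (2 * s * of_real (1 - cos t)) / D / (2 * of_real pi) =
      ((1 - cos t) / pi) *\<^sub>R (1 / (complex_of_real (2 + 2 * cos t) - z))"
    unfolding z_D using s D by (simp add: scaleR_conv_of_real mult.commute)
  ultimately show ?thesis by simp
qed

lemma m_MP_joukowski:
  assumes s: "s \<noteq> 0" "cmod s < 1" and z: "z = 2 + s + 1 / s" and im: "Im z > 0"
  shows "m_MP z = - s / (1 + s)"
proof -
  have s1: "1 + s \<noteq> 0" using s by (metis add_eq_0_iff norm_minus_cancel norm_one less_irrefl)
  define H where "H t = ((1 - s) / (1 + s) * poisson_primitive s t - of_real t) / (2 * of_real pi)" for t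
  have "((\<lambda>x. rho_MP x *\<^sub>R (1 / (complex_of_real x - z))) has_integral (H pi - H 0)) UNIV"
    unfolding H_def by (rule has_integral_rho_MP_scaleR[OF has_vector_derivative_m_MP_primitive[OF assms]])
  moreover have "integrable lborel (\<lambda>x. rho_MP x *\<^sub>R (1 / (complex_of_real x - z)))"
    using MP.integrable_inverse_of_real_minus[OF im]
    by (subst (asm) integrable_density) (auto simp: rho_MP_nonneg)
  then have "((\<lambda>x. rho_MP x *\<^sub>R (1 / (complex_of_real x - z))) has_integral
      (LINT x|lborel. rho_MP x *\<^sub>R (1 / (complex_of_real x - z)))) UNIV"
    by (rule has_integral_integral_lborel)
  ultimately have "(LINT x|lborel. rho_MP x *\<^sub>R (1 / (complex_of_real x - z))) = H pi - H 0"
    by (rule has_integral_unique[symmetric])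
  moreover have cis_minus_pi: "cis (- pi) = - 1" by (simp add: complex_eq_iff)
  ultimately have "m_MP z = H pi - H 0"
    by (simp add: m_MP_def scaleR_conv_of_real mult.commute)
  also have "\<dots> = ((1 - s) / (1 + s) * of_real pi - of_real pi) / (2 * of_real pi)"
    using cis_minus_pi by (simp add: H_def poisson_primitive_def)
  also have "\<dots> = - s / (1 + s)"
    using s1 by (simp add: divide_simps) (simp add: algebra_simps)
  finally show ?thesis .
qed

lemma MP_quadratic_m_MP:
  assumes im: "Im z > 0"
  shows "MP_quadratic z (m_MP z) = 0"
proof -
  obtain s where s: "s \<noteq> 0" "cmod s < 1" and z: "z = 2 + s + 1 / s"
    using joukowski_root[OF im] by metis
  have s1: "1 + s \<noteq> 0" using s by (metis add_eq_0_iff norm_minus_cancel norm_one less_irrefl)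
  have z': "z = (1 + s)\<^sup>2 / s" using s by (simp add: z field_simps power2_eq_square)
  show ?thesis
    unfolding m_MP_joukowski[OF s z im] MP_quadratic_def unfolding z' using s s1
    by (simp add: divide_simps power2_eq_square)
qed

text \<open>Completing the square, \<open>(m + 1/2)\<^sup>2 = 1/4 - 1/z\<close>.\<close>

lemma MP_quadratic_root_Im_ge:
  assumes root: "MP_quadratic z m = 0" and z: "z \<noteq> 0"
  shows "Re (1 / z) - 1 / 4 \<le> (Im m)\<^sup>2"
proof -
  have "z * (m\<^sup>2 + m) = - 1"
    using root by (simp add: MP_quadratic_def distrib_left eq_neg_iff_add_eq_0)
  then have "m\<^sup>2 + m = - 1 / z" using z by (metis nonzero_mult_div_cancel_left)
  moreover have "(m + 1 / 2)\<^sup>2 = (m\<^sup>2 + m) + 1 / 4"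
    by (simp add: power2_eq_square algebra_simps)
  ultimately have "Re ((m + 1 / 2)\<^sup>2) = 1 / 4 - Re (1 / z)" by simp
  moreover have "Re ((m + 1 / 2)\<^sup>2) = (Re m + 1 / 2)\<^sup>2 - (Im m)\<^sup>2"
    by (simp add: power2_eq_square)
  ultimately show ?thesis
    using zero_le_power2[of "Re m + 1 / 2"] by linarith
qed

lemma Re_inverse_bulk_ge:
  assumes \<kappa>: "0 < \<kappa>" and re: "\<kappa> \<le> Re z" "Re z \<le> 4 - \<kappa>" and im: "\<bar>Im z\<bar> \<le> \<kappa> / 2"
  shows "1 / 4 + \<kappa> / 32 \<le> Re (1 / z)"
proof -
  have pos: "0 < Re z" using \<kappa> re by simp
  have "(Im z)\<^sup>2 \<le> (\<kappa> / 2)\<^sup>2" using power_mono[OF im abs_ge_zero, of 2] by simp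
  also have "\<dots> \<le> \<kappa> / 2 * Re z" using re \<kappa> by (simp add: power2_eq_square)
  finally have "(Re z)\<^sup>2 + (Im z)\<^sup>2 \<le> Re z * (Re z + \<kappa> / 2)" by (simp add: power2_eq_square algebra_simps)
  also have "\<dots> \<le> Re z * (4 - \<kappa> / 2)" using re pos by (intro mult_left_mono) auto
  finally have norm: "(Re z)\<^sup>2 + (Im z)\<^sup>2 \<le> Re z * (4 - \<kappa> / 2)" .
  have "(1 / 4 + \<kappa> / 32) * (4 - \<kappa> / 2) \<le> 1"
    by (simp add: algebra_simps)
  then have "1 / 4 + \<kappa> / 32 \<le> 1 / (4 - \<kappa> / 2)"
    using re by (subst pos_le_divide_eq) auto
  also have "\<dots> = Re z / (Re z * (4 - \<kappa> / 2))" using pos by simp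
  also have "\<dots> \<le> Re z / ((Re z)\<^sup>2 + (Im z)\<^sup>2)"
    using pos norm \<kappa> re by (intro divide_left_mono) (auto simp: sum_power2_gt_zero_iff intro!: mult_pos_pos)
  finally show ?thesis by (simp add: Re_divide power2_eq_square)
qed

lemma Im_m_MP_bulk_ge:
  assumes "0 < \<kappa>" "\<kappa> \<le> Re z" "Re z \<le> 4 - \<kappa>" and im: "0 < Im z" "Im z \<le> \<kappa> / 2"
  shows "sqrt (\<kappa> / 32) \<le> Im (m_MP z)"
proof (rule real_le_lsqrt)
  show "0 \<le> Im (m_MP z)"
    unfolding m_MP_eq_stieltjes_transform by (rule MP.Im_stieltjes_transform_nonneg[OF im(1)])
  have "z \<noteq> 0" using im by auto
  then show "\<kappa> / 32 \<le> (Im (m_MP z))\<^sup>2"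
    using MP_quadratic_root_Im_ge[OF MP_quadratic_m_MP[OF im(1)]] Re_inverse_bulk_ge[of \<kappa> z] assms by simp
qed

subsection \<open>Trigonometric polynomials under a bounded density\<close>

definition trig_poly :: "'i set \<Rightarrow> ('i \<Rightarrow> complex) \<Rightarrow> ('i \<Rightarrow> int) \<Rightarrow> real \<Rightarrow> complex" where
  "trig_poly I a n u = (\<Sum>i\<in>I. a i * cis (2 * pi * (of_int (n i) * u)))"

lemma borel_measurable_trig_poly [measurable]: "trig_poly I a n \<in> borel_measurable borel"
  unfolding trig_poly_def[abs_def] by (intro borel_measurable_continuous_onI continuous_intros)

lemma trig_poly_group_frequencies:
  fixes f g :: "'i \<Rightarrow> int"
  assumes I: "finite I"
  shows "(\<Sum>i\<in>I. a i * cis (2 * pi * (of_int (f i) * u + of_int (g i) * v))) =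
    trig_poly (f ` I) (\<lambda>\<nu>. trig_poly {i \<in> I. f i = \<nu>} a g v) id u"
proof -
  have "(\<Sum>i\<in>I. a i * cis (2 * pi * (of_int (f i) * u + of_int (g i) * v))) =
      (\<Sum>\<nu>\<in>f ` I. \<Sum>i\<in>{i \<in> I. f i = \<nu>}. a i * cis (2 * pi * (of_int (f i) * u + of_int (g i) * v)))"
    by (rule sum.image_gen[OF I])
  also have "\<dots> = trig_poly (f ` I) (\<lambda>\<nu>. trig_poly {i \<in> I. f i = \<nu>} a g v) id u"
    unfolding trig_poly_def sum_distrib_right
    by (intro sum.cong refl) (auto simp: cis_mult[symmetric] distrib_left mult_ac)
  finally show ?thesis .
qed

lemma has_bochner_integral_cis:
  fixes n :: int
  shows "has_bochner_integral lborel (\<lambda>u. indicator {0..1} u *\<^sub>R cis (2 * pi * (of_int n * u)))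
    (if n = 0 then 1 else 0)"
proof (cases "n = 0")
  case True
  have "has_bochner_integral lborel (\<lambda>u::real. indicator {0..1} u *\<^sub>R (1::complex))
      (measure lborel {0..1::real} *\<^sub>R 1)"
    by (intro has_bochner_integral_scaleR_left has_bochner_integral_real_indicator) auto
  then show ?thesis using True by simp
next
  case False
  let ?F = "\<lambda>u. cis (2 * pi * (of_int n * u)) / (2 * of_real pi * of_int n * \<i>)"
  have "has_bochner_integral lborel (\<lambda>u. indicator {0..1} u *\<^sub>R cis (2 * pi * (of_int n * u))) (?F 1 - ?F 0)"
  proof (rule has_bochner_integral_FTC_Icc)
    fix u :: real
    have "((\<lambda>\<tau>. exp (\<i> * (2 * of_real pi * (of_int n * \<tau>))) / (2 * of_real pi * of_int n * \<i>))
        has_field_derivative exp (\<i> * (2 * of_real pi * (of_int n * of_real u)))) (at (of_real u))"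
      using False by (auto intro!: derivative_eq_intros)
    from has_vector_derivative_real_field[OF this, of "{0..1}"]
    show "(?F has_vector_derivative cis (2 * pi * (of_int n * u))) (at u within {0..1})"
      by (simp add: cis_conv_exp)
  qed (auto intro!: continuous_intros)
  moreover have "cis (2 * pi * of_int n) = 1"
    by (simp add: cis_multiple_2pi)
  ultimately show ?thesis using False by simp
qed

lemma has_bochner_integral_trig_poly_power2:
  assumes I: "finite I" and inj: "inj_on n I"
  shows "has_bochner_integral lborel (\<lambda>u. indicator {0..1} u * (cmod (trig_poly I a n u))\<^sup>2)
    (\<Sum>i\<in>I. (cmod (a i))\<^sup>2)"
proof -
  let ?cis = "\<lambda>i k u. cis (2 * pi * (of_int (n i - n k) * u))"
  have expand: "complex_of_real ((cmod (trig_poly I a n u))\<^sup>2) =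
      (\<Sum>i\<in>I. \<Sum>k\<in>I. a i * cnj (a k) * ?cis i k u)" for u
    unfolding complex_norm_square trig_poly_def cnj_sum sum_product
    by (intro sum.cong refl) (simp add: cis_cnj cis_mult mult_ac algebra_simps)
  have "has_bochner_integral lborel (\<lambda>u. \<Sum>i\<in>I. \<Sum>k\<in>I. a i * cnj (a k) * (indicator {0..1} u *\<^sub>R ?cis i k u))
      (\<Sum>i\<in>I. \<Sum>k\<in>I. a i * cnj (a k) * (if n i - n k = 0 then 1 else 0))"
    by (intro has_bochner_integral_sum has_bochner_integral_mult_right has_bochner_integral_cis)
  moreover have "(\<Sum>k\<in>I. a i * cnj (a k) * (if n i - n k = 0 then 1 else 0)) = complex_of_real ((cmod (a i))\<^sup>2)"
    if "i \<in> I" for i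
  proof -
    have "(\<Sum>k\<in>I. a i * cnj (a k) * (if n i - n k = 0 then 1 else 0)) =
        (\<Sum>k\<in>I. if k = i then a i * cnj (a i) else 0)"
      using that inj by (intro sum.cong) (auto dest: inj_onD)
    then show ?thesis using that I by (simp add: complex_norm_square del: of_real_power)
  qed
  ultimately have "has_bochner_integral lborel
      (\<lambda>u. complex_of_real (indicator {0..1} u * (cmod (trig_poly I a n u))\<^sup>2)) (complex_of_real (\<Sum>i\<in>I. (cmod (a i))\<^sup>2))"
    by (simp add: expand of_real_mult scaleR_conv_of_real sum_distrib_left mult_ac del: of_real_power)
  from has_bochner_integral_bounded_linear[OF bounded_linear_Re this] show ?thesis by simp
qed

definition torus_measure :: "(real \<Rightarrow> real) \<Rightarrow> real measure" where
  "torus_measure \<rho> = density lborel (\<lambda>x. ennreal (\<rho> x * indicator {0..<1} x))"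

lemma sets_torus_measure [simp, measurable_cong]: "sets (torus_measure \<rho>) = sets borel"
  by (simp add: torus_measure_def)

locale bounded_density =
  fixes \<rho> :: "real \<Rightarrow> real" and B :: real
  assumes density_measurable [measurable]: "\<rho> \<in> borel_measurable borel"
    and bound_nonneg: "0 \<le> B"
    and density_le: "\<And>x. x \<in> {0..1} \<Longrightarrow> \<rho> x \<le> B"
begin

lemma nn_integral_torus_measure_le:
  assumes [measurable]: "h \<in> borel_measurable borel"
  shows "(\<integral>\<^sup>+u. h u \<partial>torus_measure \<rho>) \<le> ennreal B * (\<integral>\<^sup>+u. h u * indicator {0..1} u \<partial>lborel)"
proof -
  have "(\<integral>\<^sup>+u. h u \<partial>torus_measure \<rho>) = (\<integral>\<^sup>+u. ennreal (\<rho> u * indicator {0..<1} u) * h u \<partial>lborel)"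
    unfolding torus_measure_def by (subst nn_integral_density) auto
  also have "\<dots> \<le> (\<integral>\<^sup>+u. ennreal B * (h u * indicator {0..1} u) \<partial>lborel)"
    using density_le by (intro nn_integral_mono) (auto simp: indicator_def intro!: mult_right_mono ennreal_leI)
  also have "\<dots> = ennreal B * (\<integral>\<^sup>+u. h u * indicator {0..1} u \<partial>lborel)"
    by (intro nn_integral_cmult) measurable
  finally show ?thesis .
qed

lemma nn_integral_trig_poly_power2_le:
  assumes "finite I" "inj_on n I"
  shows "(\<integral>\<^sup>+u. ennreal ((cmod (trig_poly I a n u))\<^sup>2) \<partial>torus_measure \<rho>) \<le> ennreal (B * (\<Sum>i\<in>I. (cmod (a i))\<^sup>2))"
proof -
  have "(\<integral>\<^sup>+u. ennreal ((cmod (trig_poly I a n u))\<^sup>2) * indicator {0..1} u \<partial>lborel) =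
      (\<integral>\<^sup>+u. ennreal (indicator {0..1} u * (cmod (trig_poly I a n u))\<^sup>2) \<partial>lborel)"
    by (intro nn_integral_cong) (simp add: indicator_def)
  also have "\<dots> = ennreal (\<Sum>i\<in>I. (cmod (a i))\<^sup>2)"
    using has_bochner_integral_trig_poly_power2[OF assms, of a]
    by (subst nn_integral_eq_integral) (auto simp: has_bochner_integral_iff)
  finally show ?thesis
    using nn_integral_torus_measure_le[of "\<lambda>u. ennreal ((cmod (trig_poly I a n u))\<^sup>2)"] bound_nonneg
    by (simp add: ennreal_mult')
qed

text \<open>Grouping the terms by their frequency in \<open>u\<close> reduces two variables to one, twice.\<close>

lemma nn_integral_trig_poly2_power2_le:
  fixes f g :: "'i \<Rightarrow> int"
  assumes I: "finite I" and inj: "inj_on (\<lambda>i. (f i, g i)) I"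
  shows "(\<integral>\<^sup>+v. \<integral>\<^sup>+u. ennreal ((cmod (\<Sum>i\<in>I. a i * cis (2 * pi * (of_int (f i) * u + of_int (g i) * v))))\<^sup>2)
      \<partial>torus_measure \<rho> \<partial>torus_measure \<rho>) \<le> ennreal (B\<^sup>2 * (\<Sum>i\<in>I. (cmod (a i))\<^sup>2))"
proof -
  define I' where "I' \<nu> = {i \<in> I. f i = \<nu>}" for \<nu>
  define b where "b v \<nu> = trig_poly (I' \<nu>) a g v" for v \<nu>
  have [measurable]: "(\<lambda>v. b v \<nu>) \<in> borel_measurable borel" for \<nu>
    unfolding b_def[abs_def] by measurable
  have inj': "inj_on g (I' \<nu>)" for \<nu>
    using inj by (auto simp: inj_on_def I'_def)
  have "(\<Sum>i\<in>I. a i * cis (2 * pi * (of_int (f i) * u + of_int (g i) * v))) = trig_poly (f ` I) (b v) id u" for u v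
    unfolding b_def I'_def by (rule trig_poly_group_frequencies[OF I])
  then have "(\<integral>\<^sup>+v. \<integral>\<^sup>+u. ennreal ((cmod (\<Sum>i\<in>I. a i * cis (2 * pi * (of_int (f i) * u + of_int (g i) * v))))\<^sup>2)
      \<partial>torus_measure \<rho> \<partial>torus_measure \<rho>) \<le>
      (\<integral>\<^sup>+v. ennreal (B * (\<Sum>\<nu>\<in>f ` I. (cmod (b v \<nu>))\<^sup>2)) \<partial>torus_measure \<rho>)"
    using I by (simp add: nn_integral_mono nn_integral_trig_poly_power2_le)
  also have "\<dots> = ennreal B * (\<Sum>\<nu>\<in>f ` I. \<integral>\<^sup>+v. ennreal ((cmod (b v \<nu>))\<^sup>2) \<partial>torus_measure \<rho>)"
    using bound_nonneg
    by (simp add: ennreal_mult' nn_integral_cmult nn_integral_sum sum_ennreal[symmetric] del: sum_ennreal)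
  also have "\<dots> \<le> ennreal B * (\<Sum>\<nu>\<in>f ` I. ennreal (B * (\<Sum>i\<in>I' \<nu>. (cmod (a i))\<^sup>2)))"
    unfolding b_def using I
    by (intro mult_left_mono sum_mono nn_integral_trig_poly_power2_le inj') (auto simp: I'_def)
  also have "\<dots> = ennreal (B\<^sup>2 * (\<Sum>\<nu>\<in>f ` I. \<Sum>i\<in>I' \<nu>. (cmod (a i))\<^sup>2))"
    using bound_nonneg
    by (simp add: ennreal_mult'[symmetric] sum_nonneg sum_distrib_left power2_eq_square mult.assoc)
  also have "(\<Sum>\<nu>\<in>f ` I. \<Sum>i\<in>I' \<nu>. (cmod (a i))\<^sup>2) = (\<Sum>i\<in>I. (cmod (a i))\<^sup>2)"
    unfolding I'_def by (rule sum.image_gen[OF I, symmetric])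
  finally show ?thesis .
qed

end

subsection \<open>Measurability of the quadratic forms\<close>

lemma borel_measurable_cnj [measurable (raw)]:
  "f \<in> borel_measurable M \<Longrightarrow> (\<lambda>x. cnj (f x)) \<in> borel_measurable M"
  by (rule borel_measurable_continuous_on[OF continuous_on_cnj[OF continuous_on_id], unfolded id_def])

lemma borel_measurable_det:
  fixes A :: "'b \<Rightarrow> complex mat"
  assumes A: "\<And>x. A x \<in> carrier_mat n n"
    and m: "\<And>i k. i < n \<Longrightarrow> k < n \<Longrightarrow> (\<lambda>x. A x $$ (i, k)) \<in> borel_measurable M"
  shows "(\<lambda>x. Determinant.det (A x)) \<in> borel_measurable M"
proof -
  have "(\<lambda>x. signof p * (\<Prod>i = 0..<n. A x $$ (i, p i))) \<in> borel_measurable M"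
    if "p permutes {0..<n}" for p
    using permutes_in_image[OF that]
    by (intro borel_measurable_times borel_measurable_const borel_measurable_prod m) auto
  then show ?thesis
    unfolding det_def'[OF A] by (intro borel_measurable_sum) auto
qed

lemma borel_measurable_resolvent:
  fixes A :: "'b \<Rightarrow> complex mat"
  assumes A: "\<And>x. A x \<in> carrier_mat n n"
    and m: "\<And>i k. i < n \<Longrightarrow> k < n \<Longrightarrow> (\<lambda>x. A x $$ (i, k)) \<in> borel_measurable M"
    and ij: "i < n" "j < n"
  shows "(\<lambda>x. resolvent (A x) z $$ (i, j)) \<in> borel_measurable M"
proof -
  define C where "C x = char_matrix (A x) z" for x
  have C: "C x \<in> carrier_mat n n" for x using A by (simp add: C_def)
  have mC [measurable]: "(\<lambda>x. C x $$ (i, k)) \<in> borel_measurable M" if "i < n" "k < n" for i k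
    using m[OF that] that carrier_matD[OF A] by (simp add: C_def char_matrix_def)
  have [measurable]: "(\<lambda>x. Determinant.det (C x)) \<in> borel_measurable M"
    by (rule borel_measurable_det[OF C mC])
  have [measurable]: "(\<lambda>x. Determinant.det (mat_delete (C x) j i)) \<in> borel_measurable M"
  proof (rule borel_measurable_det[of _ "n - 1"])
    show "mat_delete (C x) j i \<in> carrier_mat (n - 1) (n - 1)" for x
      by (rule mat_delete_carrier[OF C])
    fix i' k' assume *: "i' < n - 1" "k' < n - 1"
    then have "mat_delete (C x) j i $$ (i', k') = C x $$ (insert_index j i', insert_index i k')" for x
      using ij C[of x] mat_delete_index[of "C x" "n - 1" j i i' k'] by simp
    moreover have "insert_index j i' < n" "insert_index i k' < n"
      using * by (auto simp: insert_index_def)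
    ultimately show "(\<lambda>x. mat_delete (C x) j i $$ (i', k')) \<in> borel_measurable M"
      using mC by simp
  qed
  have "resolvent (A x) z $$ (i, j) = inverse (Determinant.det (C x)) *
      ((- 1) ^ (j + i) * Determinant.det (mat_delete (C x) j i))" for x
    using ij carrier_matD[OF C[of x]] by (simp add: resolvent_def C_def[symmetric] adj_mat_def cofactor_def)
  then show ?thesis by simp
qed

lemma borel_measurable_gram:
  fixes X :: "'b \<Rightarrow> complex mat"
  assumes X: "\<And>x. X x \<in> carrier_mat n m"
    and [measurable]: "\<And>i k. i < n \<Longrightarrow> k < m \<Longrightarrow> (\<lambda>x. X x $$ (i, k)) \<in> borel_measurable M"
    and kl: "k < m" "l < m"
  shows "(\<lambda>x. gram (X x) $$ (k, l)) \<in> borel_measurable M"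
  unfolding gram_index[OF X kl] using kl
  by (intro borel_measurable_sum borel_measurable_times borel_measurable_cnj) auto

lemma row_form_eq_sum:
  assumes X: "X \<in> carrier_mat n m" and j: "j < n"
  shows "row_form X z j =
    (\<Sum>k<m. \<Sum>l<m. resolvent (gram (zero_row X j)) z $$ (k, l) * cnj (X $$ (j, l)) * X $$ (j, k))"
proof -
  note R = resolvent_carrier[OF gram_carrier[OF zero_row_carrier[OF X]]]
  show ?thesis
    unfolding row_form_def mult_mat_vec_cscalar_prod[OF R adjoint_row_carrier[OF X] adjoint_row_carrier[OF X]]
    using carrier_matD[OF X] j by (intro sum.cong refl) (simp add: conjugate_complex_def)
qed

lemma borel_measurable_row_dev:
  fixes X :: "'b \<Rightarrow> complex mat"
  assumes X: "\<And>x. X x \<in> carrier_mat n m" and j: "j < n"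
    and [measurable]: "\<And>i k. i < n \<Longrightarrow> k < m \<Longrightarrow> (\<lambda>x. X x $$ (i, k)) \<in> borel_measurable M"
  shows "(\<lambda>x. row_dev (X x) z j) \<in> borel_measurable M"
proof -
  note X' = zero_row_carrier[OF X, of _ j]
  have "(\<lambda>x. zero_row (X x) j $$ (i, k)) \<in> borel_measurable M" if "i < n" "k < m" for i k
    using that carrier_matD[OF X] by (simp add: zero_row_def)
  then have [measurable]: "(\<lambda>x. resolvent (gram (zero_row (X x) j)) z $$ (k, l)) \<in> borel_measurable M"
    if "k < m" "l < m" for k l
    using that by (intro borel_measurable_resolvent[OF gram_carrier[OF X']] borel_measurable_gram[OF X'])
  show ?thesis
    unfolding row_dev_def row_form_eq_sum[OF X j] mat_stieltjes_gram[OF X']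
      mat_trace_sum[OF resolvent_carrier[OF gram_carrier[OF X']]]
    using j by (intro borel_measurable_diff borel_measurable_divide borel_measurable_sum borel_measurable_times
        borel_measurable_cnj borel_measurable_const) auto
qed

lemma borel_measurable_X_mat:
  assumes [measurable]: "\<And>j q. j \<in> {1..N} \<Longrightarrow> q \<in> {1..d} \<Longrightarrow> (\<lambda>x. w x j q) \<in> borel_measurable M"
    and jk: "j < N" "k < N"
  shows "(\<lambda>x. X_mat N d (w x) $$ (j, k)) \<in> borel_measurable M"
proof -
  have [measurable]: "(\<lambda>x. phase d (w x) j k) \<in> borel_measurable M"
    unfolding phase_def using jk by (intro borel_measurable_sum borel_measurable_times) auto
  have [measurable]: "cis \<in> borel_measurable borel"
    by (intro borel_measurable_continuous_onI continuous_intros)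
  show ?thesis unfolding X_mat_index[OF jk] by measurable
qed

subsection \<open>Second moments of the quadratic forms\<close>

lemma X_mat_cong:
  assumes "\<And>j q. j \<in> {1..N} \<Longrightarrow> q \<in> {1..d} \<Longrightarrow> w j q = w' j q"
  shows "X_mat N d w = X_mat N d w'"
proof (rule eq_matI)
  fix j k assume "j < dim_row (X_mat N d w')" "k < dim_col (X_mat N d w')"
  then have jk: "j < N" "k < N" by (auto simp: X_mat_def)
  then have "phase d w j k = phase d w' j k"
    using assms unfolding phase_def by (intro sum.cong) auto
  then show "X_mat N d w $$ (j, k) = X_mat N d w' $$ (j, k)"
    by (simp only: X_mat_index[OF jk])
qed (auto simp: X_mat_def)

definition offdiag :: "nat \<Rightarrow> (nat \<times> nat) set" where
  "offdiag n = {p \<in> {..<n} \<times> {..<n}. fst p \<noteq> snd p}"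

lemma finite_offdiag [simp]: "finite (offdiag n)"
  by (simp add: offdiag_def)

lemma sum_offdiag:
  fixes F :: "nat \<times> nat \<Rightarrow> 'a :: comm_monoid_add"
  shows "(\<Sum>p\<in>{..<n} \<times> {..<n}. F p) = (\<Sum>p\<in>offdiag n. F p) + (\<Sum>k<n. F (k, k))"
proof -
  have "{..<n} \<times> {..<n} = offdiag n \<union> (\<lambda>k. (k, k)) ` {..<n}"
    by (auto simp: offdiag_def)
  moreover have "offdiag n \<inter> (\<lambda>k. (k, k)) ` {..<n} = {}"
    by (auto simp: offdiag_def)
  ultimately show ?thesis
    by (simp add: sum.union_disjoint sum.reindex inj_on_def)
qed

lemma row_dev_unimodular_row:
  assumes X: "X \<in> carrier_mat n m" and j: "j < n" and m: "m > 0"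
    and row: "\<And>k. k < m \<Longrightarrow> X $$ (j, k) = of_real (1 / sqrt (real m)) * cis (\<phi> k)"
  shows "row_dev X z j =
    (\<Sum>p\<in>offdiag m. resolvent (gram (zero_row X j)) z $$ p / of_nat m * cis (\<phi> (fst p) - \<phi> (snd p)))"
proof -
  define R where "R = resolvent (gram (zero_row X j)) z"
  define F where "F p = R $$ p / of_nat m * cis (\<phi> (fst p) - \<phi> (snd p))" for p
  have R: "R \<in> carrier_mat m m"
    unfolding R_def by (rule resolvent_carrier[OF gram_carrier[OF zero_row_carrier[OF X]]])
  have "R $$ (k, l) * cnj (X $$ (j, l)) * X $$ (j, k) = F (k, l)" if "k < m" "l < m" for k l
  proof -
    define r where "r = 1 / sqrt (real m)"
    have "r * r = 1 / real m" by (simp add: r_def)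
    moreover have "cnj (X $$ (j, l)) * X $$ (j, k) = of_real (r * r) * cis (\<phi> k - \<phi> l)"
      unfolding row[OF that(1)] row[OF that(2)] r_def[symmetric] by (simp add: cis_cnj cis_mult)
    ultimately show ?thesis by (simp add: F_def mult.assoc)
  qed
  then have "row_form X z j = (\<Sum>p\<in>{..<m} \<times> {..<m}. F p)"
    unfolding row_form_eq_sum[OF X j] R_def[symmetric] by (simp add: sum.cartesian_product)
  also have "\<dots> = (\<Sum>p\<in>offdiag m. F p) + (\<Sum>k<m. F (k, k))" by (rule sum_offdiag)
  also have "(\<Sum>k<m. F (k, k)) = mat_stieltjes (gram (zero_row X j)) z"
    by (simp add: F_def mat_stieltjes_gram[OF zero_row_carrier[OF X]] R_def[symmetric] mat_trace_sum[OF R]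
        sum_divide_distrib)
  finally show ?thesis by (simp add: row_dev_def F_def R_def)
qed

definition upd_phases :: "(nat \<Rightarrow> nat \<Rightarrow> real) \<Rightarrow> nat \<Rightarrow> real \<Rightarrow> real \<Rightarrow> nat \<Rightarrow> nat \<Rightarrow> real" where
  "upd_phases w j u v = w(j + 1 := (w (j + 1))(1 := u, 2 := v))"

lemma phase_upd_phases:
  assumes "2 \<le> d"
  shows "phase d (upd_phases w j u v) j k =
    real (k + 1) * u + (real (k + 1))\<^sup>2 * v + (\<Sum>q = 3..d. w (j + 1) q * real (k + 1) ^ q)"
proof -
  have "{1..d} = insert 1 (insert 2 {3..d})" using assms by auto
  then show ?thesis by (simp add: phase_def upd_phases_def)
qed

lemma zero_row_X_mat_upd_phases:
  "zero_row (X_mat N d (upd_phases w j u v)) j = zero_row (X_mat N d w) j"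
  by (rule eq_matI) (auto simp: zero_row_def X_mat_def upd_phases_def)

definition frequency :: "nat \<times> nat \<Rightarrow> int \<times> int" where
  "frequency p = (int (fst p) - int (snd p), (int (fst p) + 1)\<^sup>2 - (int (snd p) + 1)\<^sup>2)"

text \<open>For \<open>k \<noteq> l\<close> the pair \<open>(k - l, k\<^sup>2 - l\<^sup>2)\<close> determines \<open>k - l\<close> and \<open>k + l\<close>.\<close>

lemma inj_on_frequency: "inj_on frequency (offdiag n)"
proof (rule inj_onI)
  fix p p' assume p: "p \<in> offdiag n" and eq: "frequency p = frequency p'"
  have factor: "(int k + 1)\<^sup>2 - (int l + 1)\<^sup>2 = (int k - int l) * (int k + int l + 2)" for k l
    by (simp add: power2_eq_square algebra_simps)
  have diff: "int (fst p) - int (snd p) = int (fst p') - int (snd p')"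
    using eq by (simp add: frequency_def)
  then have "(int (fst p) - int (snd p)) * (int (fst p) + int (snd p) + 2) =
      (int (fst p) - int (snd p)) * (int (fst p') + int (snd p') + 2)"
    using eq by (simp add: frequency_def factor)
  moreover have "int (fst p) - int (snd p) \<noteq> 0" using p by (simp add: offdiag_def)
  ultimately have "int (fst p) + int (snd p) = int (fst p') + int (snd p')" by simp
  with diff have "fst p = fst p'" "snd p = snd p'" by linarith+
  then show "p = p'" by (rule prod_eqI)
qed

lemma row_dev_X_mat_upd_phases:
  fixes w :: "nat \<Rightarrow> nat \<Rightarrow> real" and z :: complex
  assumes j: "j < N" and d: "2 \<le> d"
  defines "R \<equiv> resolvent (gram (zero_row (X_mat N d w) j)) z"
    and "r \<equiv> \<lambda>k. \<Sum>q = 3..d. w (j + 1) q * real (k + 1) ^ q"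
  shows "row_dev (X_mat N d (upd_phases w j u v)) z j =
    (\<Sum>p\<in>offdiag N. R $$ p / of_nat N * cis (2 * pi * (r (fst p) - r (snd p))) *
      cis (2 * pi * (of_int (fst (frequency p)) * u + of_int (snd (frequency p)) * v)))"
proof -
  let ?\<phi> = "\<lambda>k. 2 * pi * phase d (upd_phases w j u v) j k"
  have "?\<phi> (fst p) - ?\<phi> (snd p) = 2 * pi * (r (fst p) - r (snd p)) +
      2 * pi * (of_int (fst (frequency p)) * u + of_int (snd (frequency p)) * v)" for p
    by (simp add: phase_upd_phases[OF d] r_def frequency_def algebra_simps)
  then have "cis (?\<phi> (fst p) - ?\<phi> (snd p)) = cis (2 * pi * (r (fst p) - r (snd p))) *
      cis (2 * pi * (of_int (fst (frequency p)) * u + of_int (snd (frequency p)) * v))" for p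
    by (simp only: cis_mult)
  then show ?thesis
    using row_dev_unimodular_row[OF X_mat_carrier j _ X_mat_index[OF j], of d "upd_phases w j u v" z] j
    by (simp add: zero_row_X_mat_upd_phases R_def mult.assoc)
qed

lemma (in bounded_density) nn_integral_row_dev_upd_phases_le:
  assumes j: "j < N" and d: "2 \<le> d" and z: "Im z > 0"
  shows "(\<integral>\<^sup>+v. \<integral>\<^sup>+u. ennreal ((cmod (row_dev (X_mat N d (upd_phases w j u v)) z j))\<^sup>2)
      \<partial>torus_measure \<rho> \<partial>torus_measure \<rho>) \<le> ennreal (B\<^sup>2 / (real N * (Im z)\<^sup>2))"
proof -
  define R where "R = resolvent (gram (zero_row (X_mat N d w) j)) z"
  define r where "r k = (\<Sum>q = 3..d. w (j + 1) q * real (k + 1) ^ q)" for k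
  define a where "a p = R $$ p / of_nat N * cis (2 * pi * (r (fst p) - r (snd p)))" for p
  have "(\<Sum>p\<in>offdiag N. (cmod (a p))\<^sup>2) = (\<Sum>p\<in>offdiag N. (cmod (R $$ p))\<^sup>2) / (real N)\<^sup>2"
    by (simp add: a_def norm_mult norm_divide power_divide sum_divide_distrib)
  also have "\<dots> \<le> (\<Sum>p\<in>{..<N} \<times> {..<N}. (cmod (R $$ p))\<^sup>2) / (real N)\<^sup>2"
    by (intro divide_right_mono sum_mono2) (auto simp: offdiag_def)
  also have "\<dots> \<le> (real N / (Im z)\<^sup>2) / (real N)\<^sup>2"
    unfolding R_def
    by (intro divide_right_mono z
        resolvent_Frobenius_le[OF hermitian_gram[OF zero_row_carrier[OF X_mat_carrier]]]) simp
  also have "\<dots> = 1 / (real N * (Im z)\<^sup>2)"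
    using j by (simp add: power2_eq_square)
  finally have coefficients: "(\<Sum>p\<in>offdiag N. (cmod (a p))\<^sup>2) \<le> 1 / (real N * (Im z)\<^sup>2)" .
  have "inj_on (\<lambda>p. (fst (frequency p), snd (frequency p))) (offdiag N)"
    using inj_on_frequency[of N] by simp
  then have "(\<integral>\<^sup>+v. \<integral>\<^sup>+u. ennreal ((cmod (row_dev (X_mat N d (upd_phases w j u v)) z j))\<^sup>2)
      \<partial>torus_measure \<rho> \<partial>torus_measure \<rho>) \<le> ennreal (B\<^sup>2 * (\<Sum>p\<in>offdiag N. (cmod (a p))\<^sup>2))"
    unfolding row_dev_X_mat_upd_phases[OF j d] R_def[symmetric] r_def[symmetric] a_def[symmetric]
    by (rule nn_integral_trig_poly2_power2_le[OF finite_offdiag])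
  also have "\<dots> \<le> ennreal (B\<^sup>2 / (real N * (Im z)\<^sup>2))"
    using mult_left_mono[OF coefficients, of "B\<^sup>2"] by (intro ennreal_leI) simp
  finally show ?thesis .
qed

subsection \<open>The array of random phases\<close>

context product_prob_space
begin

lemma borel_measurable_nn_integral_fun_upd:
  assumes "i \<in> I" and g: "g \<in> borel_measurable (Pi\<^sub>M I M)"
  shows "(\<lambda>y. \<integral>\<^sup>+u. g (y(i := u)) \<partial>M i) \<in> borel_measurable (Pi\<^sub>M I M)"
proof (rule M.borel_measurable_nn_integral)
  have "(\<lambda>(y, u). y(i := u)) \<in> measurable (Pi\<^sub>M I M \<Otimes>\<^sub>M M i) (Pi\<^sub>M I M)"
    using measurable_add_dim[of i I M] assms(1) by (simp add: insert_absorb)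
  from measurable_compose[OF this g]
  show "(\<lambda>(y, u). g (y(i := u))) \<in> borel_measurable (Pi\<^sub>M I M \<Otimes>\<^sub>M M i)"
    by (simp add: case_prod_unfold)
qed

lemma nn_integral_PiM_fun_upd:
  assumes I: "finite I" "i \<in> I" and g: "g \<in> borel_measurable (Pi\<^sub>M I M)"
  shows "(\<integral>\<^sup>+y. g y \<partial>Pi\<^sub>M I M) = (\<integral>\<^sup>+y. \<integral>\<^sup>+u. g (y(i := u)) \<partial>M i \<partial>Pi\<^sub>M I M)"
proof -
  define J where "J = I - {i}"
  have J: "finite J" "i \<notin> J" and insert: "insert i J = I" using I by (auto simp: J_def)
  note expand = product_nn_integral_insert[OF J, unfolded insert]
  have "(\<integral>\<^sup>+y. \<integral>\<^sup>+u. g (y(i := u)) \<partial>M i \<partial>Pi\<^sub>M I M) = (\<integral>\<^sup>+y. \<integral>\<^sup>+u'. \<integral>\<^sup>+u. g (y(i := u)) \<partial>M i \<partial>M i \<partial>Pi\<^sub>M J M)"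
    by (subst expand[OF borel_measurable_nn_integral_fun_upd[OF I(2) g]]) simp
  also have "\<dots> = (\<integral>\<^sup>+y. \<integral>\<^sup>+u. g (y(i := u)) \<partial>M i \<partial>Pi\<^sub>M J M)"
    by (simp add: M.emeasure_space_1)
  finally show ?thesis by (simp add: expand[OF g])
qed

end

locale bounded_torus_array = prob_space M + bounded_density \<rho> B
  for M :: "'a measure" and \<rho> :: "real \<Rightarrow> real" and B :: real +
  fixes N d :: nat and \<omega> :: "nat \<Rightarrow> nat \<Rightarrow> 'a \<Rightarrow> real"
  assumes iid: "iid_torus_array M \<rho> N d \<omega>" and N: "1 \<le> N" and d: "2 \<le> d"
begin

abbreviation indices :: "(nat \<times> nat) set" where
  "indices \<equiv> {1..N} \<times> {1..d}"

definition phases :: "'a \<Rightarrow> nat \<times> nat \<Rightarrow> real" where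
  "phases x = (\<lambda>i\<in>indices. \<omega> (fst i) (snd i) x)"

lemma distributed_phase:
  assumes "i \<in> indices"
  shows "distributed M lborel (\<omega> (fst i) (snd i)) (\<lambda>x. ennreal (\<rho> x * indicator {0..<1} x))"
  using iid assms by (auto simp: iid_torus_array_def)

lemma random_variable_phase: "i \<in> indices \<Longrightarrow> \<omega> (fst i) (snd i) \<in> borel_measurable M"
  using distributed_measurable[OF distributed_phase] by simp

lemma distr_phase:
  assumes "i \<in> indices"
  shows "distr M borel (\<omega> (fst i) (snd i)) = torus_measure \<rho>"
proof -
  have "distr M borel (\<omega> (fst i) (snd i)) = distr M lborel (\<omega> (fst i) (snd i))"
    by (rule distr_cong) auto
  then show ?thesis
    using distributed_distr_eq_density[OF distributed_phase[OF assms]] by (simp add: torus_measure_def)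
qed

lemma prob_space_torus_measure: "prob_space (torus_measure \<rho>)"
proof -
  have "(1, 1) \<in> indices" using N d by auto
  then show ?thesis
    using prob_space_distr[OF random_variable_phase] distr_phase by metis
qed

lemma random_variable_phases: "phases \<in> measurable M (Pi\<^sub>M indices (\<lambda>_. borel))"
  unfolding phases_def[abs_def] by (intro measurable_restrict random_variable_phase)

lemma distr_phases: "distr M (Pi\<^sub>M indices (\<lambda>_. borel)) phases = Pi\<^sub>M indices (\<lambda>_. torus_measure \<rho>)"
proof -
  have nonempty: "indices \<noteq> {}" using N d by auto
  have "indep_vars (\<lambda>_. borel) (\<lambda>i. \<omega> (fst i) (snd i)) indices"
    using iid by (simp add: iid_torus_array_def case_prod_unfold)
  then have "distr M (Pi\<^sub>M indices (\<lambda>_. borel)) phases = Pi\<^sub>M indices (\<lambda>i. distr M borel (\<omega> (fst i) (snd i)))"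
    unfolding phases_def[abs_def]
    by (subst (asm) indep_vars_iff_distr_eq_PiM'[OF nonempty random_variable_phase]) auto
  also have "\<dots> = Pi\<^sub>M indices (\<lambda>_. torus_measure \<rho>)"
    by (intro PiM_cong refl distr_phase)
  finally show ?thesis .
qed

abbreviation X :: "'a \<Rightarrow> complex mat" where
  "X x \<equiv> X_mat N d (\<lambda>j q. \<omega> j q x)"

lemma X_eq_phases: "X x = X_mat N d (\<lambda>j q. phases x (j, q))"
  by (rule X_mat_cong) (simp add: phases_def)

lemma borel_measurable_row_dev_indices:
  assumes "j < N"
  shows "(\<lambda>y. row_dev (X_mat N d (\<lambda>j q. y (j, q))) z j) \<in> borel_measurable (Pi\<^sub>M indices (\<lambda>_. borel))"
  by (intro borel_measurable_row_dev[OF X_mat_carrier assms] borel_measurable_X_mat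
      measurable_component_singleton) auto

lemma borel_measurable_row_dev_X:
  assumes "j < N"
  shows "(\<lambda>x. row_dev (X x) z j) \<in> borel_measurable M"
  unfolding X_eq_phases
  by (rule measurable_compose[OF random_variable_phases borel_measurable_row_dev_indices[OF assms]])

text \<open>Only the phases \<open>(j + 1, 1)\<close> and \<open>(j + 1, 2)\<close> are averaged; the others stay fixed.\<close>

lemma nn_integral_row_dev_le:
  assumes j: "j < N" and z: "Im z > 0"
  shows "(\<integral>\<^sup>+x. ennreal ((cmod (row_dev (X x) z j))\<^sup>2) \<partial>M) \<le> ennreal (B\<^sup>2 / (real N * (Im z)\<^sup>2))"
proof -
  define i\<^sub>1 i\<^sub>2 where "i\<^sub>1 = (j + 1, 1 :: nat)" and "i\<^sub>2 = (j + 1, 2 :: nat)"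
  define g where "g y = ennreal ((cmod (row_dev (X_mat N d (\<lambda>j q. y (j, q))) z j))\<^sup>2)" for y
  let ?\<mu> = "torus_measure \<rho>"
  interpret P: product_prob_space "\<lambda>_. ?\<mu>" indices
    by (rule product_prob_spaceI[OF prob_space_torus_measure])
  have i: "i\<^sub>1 \<in> indices" "i\<^sub>2 \<in> indices" "finite indices" using j d by (auto simp: i\<^sub>1_def i\<^sub>2_def)
  have g_borel [measurable]: "g \<in> borel_measurable (Pi\<^sub>M indices (\<lambda>_. borel))"
    unfolding g_def using borel_measurable_row_dev_indices[OF j] by measurable
  have "sets (Pi\<^sub>M indices (\<lambda>_. ?\<mu>)) = sets (Pi\<^sub>M indices (\<lambda>_. borel))"
    by (intro sets_PiM_cong) auto
  then have g: "g \<in> borel_measurable (Pi\<^sub>M indices (\<lambda>_. ?\<mu>))"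
    using g_borel by (simp cong: measurable_cong_sets)
  have "(\<integral>\<^sup>+x. ennreal ((cmod (row_dev (X x) z j))\<^sup>2) \<partial>M) = (\<integral>\<^sup>+x. g (phases x) \<partial>M)"
    by (simp add: g_def X_eq_phases)
  also have "\<dots> = (\<integral>\<^sup>+y. g y \<partial>Pi\<^sub>M indices (\<lambda>_. ?\<mu>))"
    unfolding distr_phases[symmetric]
    by (rule nn_integral_distr[OF random_variable_phases, symmetric]) (simp only: measurable_distr_eq1 g_borel)
  also have "\<dots> = (\<integral>\<^sup>+y. \<integral>\<^sup>+v. \<integral>\<^sup>+u. g (y(i\<^sub>2 := v, i\<^sub>1 := u)) \<partial>?\<mu> \<partial>?\<mu> \<partial>Pi\<^sub>M indices (\<lambda>_. ?\<mu>))"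
    unfolding P.nn_integral_PiM_fun_upd[OF i(3,1) g]
    by (rule P.nn_integral_PiM_fun_upd[OF i(3,2) P.borel_measurable_nn_integral_fun_upd[OF i(1) g]])
  also have "\<dots> \<le> (\<integral>\<^sup>+y. ennreal (B\<^sup>2 / (real N * (Im z)\<^sup>2)) \<partial>Pi\<^sub>M indices (\<lambda>_. ?\<mu>))"
  proof (rule nn_integral_mono)
    fix y :: "nat \<times> nat \<Rightarrow> real"
    have "(\<lambda>j' q. (y(i\<^sub>2 := v, i\<^sub>1 := u)) (j', q)) = upd_phases (\<lambda>j q. y (j, q)) j u v" for u v
      by (auto simp: fun_eq_iff i\<^sub>1_def i\<^sub>2_def upd_phases_def)
    then show "(\<integral>\<^sup>+v. \<integral>\<^sup>+u. g (y(i\<^sub>2 := v, i\<^sub>1 := u)) \<partial>?\<mu> \<partial>?\<mu>) \<le> ennreal (B\<^sup>2 / (real N * (Im z)\<^sup>2))"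
      using nn_integral_row_dev_upd_phases_le[OF j d z] by (simp add: g_def)
  qed
  also have "\<dots> = ennreal (B\<^sup>2 / (real N * (Im z)\<^sup>2))"
    using P.emeasure_space_1 by simp
  finally show ?thesis .
qed

lemma
  assumes j: "j < N" and z: "Im z > 0"
  shows integrable_row_dev_power2: "integrable M (\<lambda>x. (cmod (row_dev (X x) z j))\<^sup>2)"
    and expectation_row_dev_power2_le: "expectation (\<lambda>x. (cmod (row_dev (X x) z j))\<^sup>2) \<le> B\<^sup>2 / (real N * (Im z)\<^sup>2)"
proof -
  note [measurable] = borel_measurable_row_dev_X[OF j]
  note le = nn_integral_row_dev_le[OF j z]
  show "integrable M (\<lambda>x. (cmod (row_dev (X x) z j))\<^sup>2)"
    using le_less_trans[OF le ennreal_less_top] by (intro integrableI_nonneg) auto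
  show "expectation (\<lambda>x. (cmod (row_dev (X x) z j))\<^sup>2) \<le> B\<^sup>2 / (real N * (Im z)\<^sup>2)"
    by (rule integral_real_bounded[OF _ le]) simp
qed

lemma
  assumes z: "Im z > 0" and t: "t > 0"
  shows mean_sq_dev_ge_event: "{x \<in> space M. t \<le> mean_sq_dev (X x) z} \<in> events"
    and prob_mean_sq_dev_ge: "prob {x \<in> space M. t \<le> mean_sq_dev (X x) z} \<le> B\<^sup>2 / (real N * (Im z)\<^sup>2 * t)"
proof -
  let ?V = "\<lambda>x. mean_sq_dev (X x) z"
  have V: "integrable M ?V"
    unfolding mean_sq_dev_def carrier_matD[OF X_mat_carrier]
    by (intro integrable_divide Bochner_Integration.integrable_sum integrable_row_dev_power2 z) auto
  then have [measurable]: "?V \<in> borel_measurable M" by simp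
  show "{x \<in> space M. t \<le> ?V x} \<in> events" by measurable
  have "expectation ?V = (\<Sum>j<N. expectation (\<lambda>x. (cmod (row_dev (X x) z j))\<^sup>2)) / real N"
    unfolding mean_sq_dev_def carrier_matD[OF X_mat_carrier]
    by (simp add: Bochner_Integration.integral_sum integrable_row_dev_power2 z)
  also have "\<dots> \<le> (\<Sum>j<N. B\<^sup>2 / (real N * (Im z)\<^sup>2)) / real N"
    by (intro divide_right_mono sum_mono expectation_row_dev_power2_le z) auto
  also have "\<dots> = B\<^sup>2 / (real N * (Im z)\<^sup>2)" using N by simp
  finally have mean: "expectation ?V \<le> B\<^sup>2 / (real N * (Im z)\<^sup>2)" .
  have "prob {x \<in> space M. t \<le> ?V x} \<le> expectation ?V / t"
    by (rule integral_Markov_inequality_measure[OF V sets.top _ t]) (simp add: mean_sq_dev_def sum_nonneg)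
  also have "\<dots> \<le> B\<^sup>2 / (real N * (Im z)\<^sup>2) / t"
    using mean t by (intro divide_right_mono) auto
  finally show "prob {x \<in> space M. t \<le> ?V x} \<le> B\<^sup>2 / (real N * (Im z)\<^sup>2 * t)" by simp
qed

end

subsection \<open>The local law\<close>

definition bulk :: "real \<Rightarrow> real \<Rightarrow> real \<Rightarrow> complex set" where
  "bulk \<kappa> \<delta> c = {z. \<kappa> \<le> Re z \<and> Re z \<le> 4 - \<kappa> \<and> \<delta> \<le> Im z \<and> Im z \<le> c}"

lemma spectral_domain_subset_bulk:
  "\<delta> \<le> real N powr (- \<theta>) \<Longrightarrow> spectral_domain \<kappa> \<theta> c N \<subseteq> bulk \<kappa> \<delta> c"
  by (auto simp: spectral_domain_def bulk_def)

lemma m_emp_near_m_MP_bulk: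
  assumes z: "z \<in> bulk \<kappa> \<delta> (\<kappa> / 2)" and \<kappa>: "0 < \<kappa>" and \<delta>: "0 < \<delta>"
    and N: "4 \<le> sqrt (\<kappa> / 32) * (real N * \<delta> ^ 3)"
    and dev: "mean_sq_dev (X_mat N d w) z \<le> \<kappa> * \<delta>\<^sup>2 / 512"
  shows "cmod (m_emp N d w z - m_MP z) \<le> \<delta> / (2 * Im z)"
proof -
  define c where "c = sqrt (\<kappa> / 32)"
  have c: "0 < c" using \<kappa> by (simp add: c_def)
  have N0: "0 < N" using N by (cases N) auto
  have im: "\<delta> \<le> Im z" "0 < Im z" using z \<delta> by (auto simp: bulk_def)
  have m_MP: "c \<le> Im (m_MP z)"
    unfolding c_def using z im \<kappa> by (intro Im_m_MP_bulk_ge) (auto simp: bulk_def)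
  have "sqrt (mean_sq_dev (X_mat N d w) z) \<le> c * \<delta> / 4"
    using dev \<kappa> \<delta> by (intro real_le_lsqrt) (simp_all add: c_def power_divide power_mult_distrib)
  moreover have "1 / (real N * (Im z)\<^sup>2) \<le> c * \<delta> / 4"
  proof -
    have "1 / (real N * (Im z)\<^sup>2) \<le> 1 / (real N * \<delta>\<^sup>2)"
      using im \<delta> N0 by (intro divide_left_mono mult_left_mono power_mono) auto
    also have "\<dots> \<le> c * \<delta> / 4"
      using N N0 \<delta> by (simp add: c_def[symmetric] field_simps power3_eq_cube power2_eq_square)
    finally show ?thesis .
  qed
  ultimately have "sqrt (mean_sq_dev (X_mat N d w) z) + 1 / (real N * (Im z)\<^sup>2) \<le> c * \<delta> / 2" by simp
  moreover have "cmod (m_emp N d w z - m_MP z) \<le>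
      (sqrt (mean_sq_dev (X_mat N d w) z) + 1 / (real N * (Im z)\<^sup>2)) / (Im (m_MP z) * Im z)"
    unfolding m_emp_eq_mat_stieltjes[OF im(2)] using c m_MP
    by (intro mat_stieltjes_near_MP_root_mean_sq[OF X_mat_carrier im(2) N0 cnorm_adjoint_row_X_mat]
        MP_quadratic_m_MP im(2)) auto
  ultimately have "cmod (m_emp N d w z - m_MP z) \<le> (c * \<delta> / 2) / (Im (m_MP z) * Im z)"
    using c m_MP im by (elim order_trans) (intro divide_right_mono, auto)
  also have "\<dots> \<le> (c * \<delta> / 2) / (c * Im z)"
    using c m_MP im \<delta> by (intro divide_left_mono mult_right_mono mult_pos_pos) auto
  finally show ?thesis using c by simp
qed

lemma (in prob_space) prob_UN_le_card_mult:
  assumes "finite F" and events: "\<And>i. i \<in> F \<Longrightarrow> D i \<in> events" and prob: "\<And>i. i \<in> F \<Longrightarrow> prob (D i) \<le> p"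
  shows "prob (\<Union>i\<in>F. D i) \<le> real (card F) * p"
proof -
  have "prob (\<Union>i\<in>F. D i) \<le> (\<Sum>i\<in>F. prob (D i))"
    using assms by (intro finite_measure_subadditive_finite) auto
  also have "\<dots> \<le> (\<Sum>i\<in>F. p)" by (intro sum_mono prob)
  finally show ?thesis by simp
qed

lemma interval_net:
  fixes a \<epsilon> :: real
  assumes \<epsilon>: "0 < \<epsilon>" "\<epsilon> \<le> a"
  obtains G where "finite G" "real (card G) \<le> 3 * a / \<epsilon>"
    and "\<And>x. x \<in> {0..a} \<Longrightarrow> \<exists>x'\<in>G. x \<le> x' \<and> x' \<le> x + \<epsilon>"
proof
  define G where "G = (\<lambda>k. \<epsilon> * real k) ` {..nat \<lceil>a / \<epsilon>\<rceil>}"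
  show "finite G" by (simp add: G_def)
  have "1 \<le> a / \<epsilon>" using \<epsilon> by simp
  moreover have "card G \<le> nat \<lceil>a / \<epsilon>\<rceil> + 1"
    unfolding G_def using card_image_le[of "{..nat \<lceil>a / \<epsilon>\<rceil>}"] by simp
  ultimately show "real (card G) \<le> 3 * a / \<epsilon>" by linarith
  fix x assume x: "x \<in> {0..a}"
  show "\<exists>x'\<in>G. x \<le> x' \<and> x' \<le> x + \<epsilon>"
  proof (intro bexI conjI)
    have "x / \<epsilon> \<le> a / \<epsilon>" using x \<epsilon> by (simp add: divide_right_mono)
    then have "nat \<lceil>x / \<epsilon>\<rceil> \<le> nat \<lceil>a / \<epsilon>\<rceil>" by (intro nat_mono ceiling_mono)
    then show "\<epsilon> * real (nat \<lceil>x / \<epsilon>\<rceil>) \<in> G"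
      unfolding G_def by (intro imageI) (simp only: atMost_iff)
    have "0 \<le> x / \<epsilon>" using x \<epsilon> by simp
    then have "x / \<epsilon> \<le> real (nat \<lceil>x / \<epsilon>\<rceil>)" "real (nat \<lceil>x / \<epsilon>\<rceil>) \<le> x / \<epsilon> + 1" by linarith+
    then show "x \<le> \<epsilon> * real (nat \<lceil>x / \<epsilon>\<rceil>)" "\<epsilon> * real (nat \<lceil>x / \<epsilon>\<rceil>) \<le> x + \<epsilon>"
      using \<epsilon> by (simp_all add: field_simps)
  qed
qed

text \<open>Rounding goes upwards so that the imaginary part does not decrease.\<close>

definition upper_net :: "real \<Rightarrow> real \<Rightarrow> real \<Rightarrow> complex set \<Rightarrow> bool" where
  "upper_net a b \<epsilon> \<Gamma> \<longleftrightarrow> (\<forall>z. 0 \<le> Re z \<and> Re z \<le> a \<and> 0 \<le> Im z \<and> Im z \<le> b \<longrightarrow>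
     (\<exists>z'\<in>\<Gamma>. Re z \<le> Re z' \<and> Re z' \<le> Re z + \<epsilon> \<and> Im z \<le> Im z' \<and> Im z' \<le> Im z + \<epsilon>))"

lemma upper_net_exists:
  assumes \<epsilon>: "0 < \<epsilon>" "\<epsilon> \<le> a" "\<epsilon> \<le> b"
  obtains \<Gamma> where "finite \<Gamma>" "real (card \<Gamma>) \<le> 9 * a * b / \<epsilon>\<^sup>2" "upper_net a b \<epsilon> \<Gamma>"
proof -
  obtain G where G: "finite G" "real (card G) \<le> 3 * a / \<epsilon>"
    "\<And>x. x \<in> {0..a} \<Longrightarrow> \<exists>x'\<in>G. x \<le> x' \<and> x' \<le> x + \<epsilon>"
    using interval_net[OF \<epsilon>(1,2)] by blast
  obtain H where H: "finite H" "real (card H) \<le> 3 * b / \<epsilon>"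
    "\<And>y. y \<in> {0..b} \<Longrightarrow> \<exists>y'\<in>H. y \<le> y' \<and> y' \<le> y + \<epsilon>"
    using interval_net[OF \<epsilon>(1,3)] by blast
  define \<Gamma> where "\<Gamma> = (\<lambda>(x, y). Complex x y) ` (G \<times> H)"
  show ?thesis
  proof
    show "finite \<Gamma>" using G(1) H(1) by (simp add: \<Gamma>_def)
    have "real (card \<Gamma>) \<le> real (card G) * real (card H)"
      unfolding \<Gamma>_def using card_image_le[of "G \<times> H" "\<lambda>(x, y). Complex x y"] G(1) H(1)
      by (simp add: card_cartesian_product flip: of_nat_mult)
    also have "\<dots> \<le> (3 * a / \<epsilon>) * (3 * b / \<epsilon>)"
      using G(2) H(2) \<epsilon> by (intro mult_mono) auto
    finally show "real (card \<Gamma>) \<le> 9 * a * b / \<epsilon>\<^sup>2" by (simp add: power2_eq_square)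
    show "upper_net a b \<epsilon> \<Gamma>"
      unfolding upper_net_def
    proof (intro allI impI)
      fix z assume z: "0 \<le> Re z \<and> Re z \<le> a \<and> 0 \<le> Im z \<and> Im z \<le> b"
      obtain x y where "x \<in> G" "Re z \<le> x" "x \<le> Re z + \<epsilon>" "y \<in> H" "Im z \<le> y" "y \<le> Im z + \<epsilon>"
        using G(3)[of "Re z"] H(3)[of "Im z"] z by auto
      then show "\<exists>z'\<in>\<Gamma>. Re z \<le> Re z' \<and> Re z' \<le> Re z + \<epsilon> \<and> Im z \<le> Im z' \<and> Im z' \<le> Im z + \<epsilon>"
        by (intro bexI[of _ "Complex x y"]) (auto simp: \<Gamma>_def)
    qed
  qed
qed

lemma cmod_m_emp_minus_m_MP_transfer:
  assumes \<delta>: "0 < \<delta>" "\<delta> \<le> Im z" and z': "Im z \<le> Im z'" "cmod (z - z') \<le> \<delta>\<^sup>2 / 4"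
    and at_z': "cmod (m_emp N d w z' - m_MP z') \<le> \<delta> / (2 * Im z')"
  shows "cmod (m_emp N d w z - m_MP z) \<le> \<delta> / Im z"
proof -
  have im: "0 < Im z" "0 < Im z'" using \<delta> z' by auto
  have "cmod (z - z') / (Im z * Im z') \<le> (\<delta>\<^sup>2 / 4) / (Im z * \<delta>)"
    using im \<delta> z' by (intro frac_le mult_left_mono) auto
  also have "\<dots> = \<delta> / (4 * Im z)" using \<delta> by (simp add: power2_eq_square)
  finally have Lipschitz: "cmod (z - z') / (Im z * Im z') \<le> \<delta> / (4 * Im z)" .
  have "m_emp N d w z - m_MP z =
      (m_emp N d w z - m_emp N d w z') + (m_emp N d w z' - m_MP z') - (m_MP z - m_MP z')" by simp
  then have "cmod (m_emp N d w z - m_MP z) \<le>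
      cmod (m_emp N d w z - m_emp N d w z') + cmod (m_emp N d w z' - m_MP z') + cmod (m_MP z - m_MP z')"
    by (metis norm_triangle_ineq norm_triangle_ineq4 add_right_mono order_trans)
  also have "\<dots> \<le> \<delta> / (4 * Im z) + \<delta> / (2 * Im z) + \<delta> / (4 * Im z)"
  proof (intro add_mono)
    show "cmod (m_emp N d w z - m_emp N d w z') \<le> \<delta> / (4 * Im z)"
      using m_emp_Lipschitz[OF im] Lipschitz by (rule order_trans)
    show "cmod (m_MP z - m_MP z') \<le> \<delta> / (4 * Im z)"
      unfolding m_MP_eq_stieltjes_transform
      using MP.stieltjes_transform_Lipschitz[OF im] Lipschitz by (rule order_trans)
    have "\<delta> / (2 * Im z') \<le> \<delta> / (2 * Im z)"
      using im \<delta> z' by (intro divide_left_mono) auto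
    with at_z' show "cmod (m_emp N d w z' - m_MP z') \<le> \<delta> / (2 * Im z)" by (rule order_trans)
  qed
  also have "\<dots> = \<delta> / Im z" using im by (simp add: field_simps)
  finally show ?thesis .
qed

lemma local_law_from_net:
  assumes \<kappa>: "0 < \<kappa>" "\<kappa> < 1" and \<delta>: "0 < \<delta>" "\<delta> \<le> \<kappa>"
    and N: "4 \<le> sqrt (\<kappa> / 64) * (real N * \<delta> ^ 3)"
    and net: "upper_net 4 1 (\<delta>\<^sup>2 / 8) \<Gamma>"
    and dev: "\<And>z. z \<in> \<Gamma> \<inter> bulk (\<kappa> / 2) \<delta> (\<kappa> / 4) \<Longrightarrow> mean_sq_dev (X_mat N d w) z \<le> \<kappa> * \<delta>\<^sup>2 / 1024"
    and z: "z \<in> bulk \<kappa> \<delta> (\<kappa> / 8)"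
  shows "cmod (m_emp N d w z - m_MP z) \<le> \<delta> / Im z"
proof -
  have "0 \<le> Re z \<and> Re z \<le> 4 \<and> 0 \<le> Im z \<and> Im z \<le> 1" using z \<kappa> \<delta> by (auto simp: bulk_def)
  then obtain z' where z': "z' \<in> \<Gamma>" "Re z \<le> Re z'" "Re z' \<le> Re z + \<delta>\<^sup>2 / 8"
    "Im z \<le> Im z'" "Im z' \<le> Im z + \<delta>\<^sup>2 / 8"
    using net unfolding upper_net_def by blast
  have "\<delta>\<^sup>2 \<le> \<kappa>"
    using mult_mono[of \<delta> \<kappa> \<delta> 1] \<delta> \<kappa> by (simp add: power2_eq_square)
  then have bulk: "z' \<in> bulk (\<kappa> / 2) \<delta> (\<kappa> / 4)" using z z' \<kappa> by (simp add: bulk_def)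
  have "cmod (z - z') \<le> \<bar>Re (z - z')\<bar> + \<bar>Im (z - z')\<bar>" by (rule cmod_le)
  then have "cmod (z - z') \<le> \<delta>\<^sup>2 / 4" using z' by simp
  moreover have "cmod (m_emp N d w z' - m_MP z') \<le> \<delta> / (2 * Im z')"
    using bulk dev[of z'] z' \<kappa> N by (intro m_emp_near_m_MP_bulk[of _ "\<kappa> / 2"] \<delta>(1)) auto
  ultimately show ?thesis
    using z z' \<delta> by (intro cmod_m_emp_minus_m_MP_transfer) (auto simp: bulk_def)
qed

context bounded_torus_array
begin

lemma prob_mean_sq_dev_ge_bulk:
  assumes \<kappa>: "0 < \<kappa>" and \<delta>: "0 < \<delta>" and z: "\<delta> \<le> Im z"
  shows "prob {x \<in> space M. \<kappa> * \<delta>\<^sup>2 / 1024 \<le> mean_sq_dev (X x) z}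
    \<le> 1024 * B\<^sup>2 / (\<kappa> * real N * \<delta> ^ 4)"
proof -
  have "prob {x \<in> space M. \<kappa> * \<delta>\<^sup>2 / 1024 \<le> mean_sq_dev (X x) z} \<le>
      B\<^sup>2 / (real N * (Im z)\<^sup>2 * (\<kappa> * \<delta>\<^sup>2 / 1024))"
    using \<kappa> \<delta> z by (intro prob_mean_sq_dev_ge) auto
  also have "\<dots> \<le> B\<^sup>2 / (real N * \<delta>\<^sup>2 * (\<kappa> * \<delta>\<^sup>2 / 1024))"
    using \<kappa> \<delta> z N by (intro divide_left_mono mult_right_mono mult_left_mono power_mono mult_pos_pos) auto
  also have "\<dots> = 1024 * B\<^sup>2 / (\<kappa> * real N * \<delta> ^ 4)"
    by (simp add: power_numeral_reduce power2_eq_square mult_ac)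
  finally show ?thesis .
qed

abbreviation m_error :: "'a \<Rightarrow> complex \<Rightarrow> real" where
  "m_error x z \<equiv> cmod (m_emp N d (\<lambda>j q. \<omega> j q x) z - m_MP z)"

text \<open>The measurable cover \<open>A\<close> makes it unnecessary to know that the failure event is measurable.\<close>

lemma local_law_at_scale:
  assumes \<kappa>: "0 < \<kappa>" "\<kappa> < 1" and \<delta>: "0 < \<delta>" "\<delta> \<le> \<kappa>"
    and N': "4 \<le> sqrt (\<kappa> / 64) * (real N * \<delta> ^ 3)"
  obtains A where "A \<in> events" "prob A \<le> 2304 * 1024 * B\<^sup>2 / (\<kappa> * real N * \<delta> ^ 8)"
    and "{x \<in> space M. \<exists>z\<in>bulk \<kappa> \<delta> (\<kappa> / 8). \<not> m_error x z \<le> \<delta> / Im z} \<subseteq> A"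
proof -
  have "\<delta>\<^sup>2 \<le> 1" using \<delta> \<kappa> by (simp add: power_le_one)
  then obtain \<Gamma> where \<Gamma>: "finite \<Gamma>" "real (card \<Gamma>) \<le> 9 * 4 * 1 / (\<delta>\<^sup>2 / 8)\<^sup>2" "upper_net 4 1 (\<delta>\<^sup>2 / 8) \<Gamma>"
    using upper_net_exists[of "\<delta>\<^sup>2 / 8" 4 1] \<delta> by auto
  define \<Gamma>' where "\<Gamma>' = \<Gamma> \<inter> bulk (\<kappa> / 2) \<delta> (\<kappa> / 4)"
  define D where "D z = {x \<in> space M. \<kappa> * \<delta>\<^sup>2 / 1024 \<le> mean_sq_dev (X x) z}" for z
  have im: "\<delta> \<le> Im z" if "z \<in> \<Gamma>'" for z using that by (simp add: \<Gamma>'_def bulk_def)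
  have D: "D z \<in> events" if "z \<in> \<Gamma>'" for z
    unfolding D_def using im[OF that] \<delta> \<kappa> by (intro mean_sq_dev_ge_event) auto
  have fin: "finite \<Gamma>'" using \<Gamma>(1) by (simp add: \<Gamma>'_def)
  show ?thesis
  proof
    show "(\<Union>z\<in>\<Gamma>'. D z) \<in> events" using D fin by (intro sets.finite_UN) auto
    have "prob (\<Union>z\<in>\<Gamma>'. D z) \<le> real (card \<Gamma>') * (1024 * B\<^sup>2 / (\<kappa> * real N * \<delta> ^ 4))"
      using D im \<delta> \<kappa> unfolding D_def by (intro prob_UN_le_card_mult fin prob_mean_sq_dev_ge_bulk) auto
    also have "\<dots> \<le> (9 * 4 * 1 / (\<delta>\<^sup>2 / 8)\<^sup>2) * (1024 * B\<^sup>2 / (\<kappa> * real N * \<delta> ^ 4))"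
    proof (rule mult_right_mono)
      have "card \<Gamma>' \<le> card \<Gamma>" using \<Gamma>(1) by (auto simp: \<Gamma>'_def intro: card_mono)
      with \<Gamma>(2) show "real (card \<Gamma>') \<le> 9 * 4 * 1 / (\<delta>\<^sup>2 / 8)\<^sup>2" by linarith
    qed (use \<kappa> \<delta> in simp)
    also have "\<dots> = 2304 * 1024 * B\<^sup>2 / (\<kappa> * real N * \<delta> ^ 8)"
      using \<delta> by (simp add: power_divide power_mult[symmetric] power_add[symmetric] field_simps)
    finally show "prob (\<Union>z\<in>\<Gamma>'. D z) \<le> 2304 * 1024 * B\<^sup>2 / (\<kappa> * real N * \<delta> ^ 8)" .
    show "{x \<in> space M. \<exists>z\<in>bulk \<kappa> \<delta> (\<kappa> / 8). \<not> m_error x z \<le> \<delta> / Im z}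
        \<subseteq> (\<Union>z\<in>\<Gamma>'. D z)"
    proof (intro subsetI, rule ccontr)
      fix x
      assume x: "x \<in> {x \<in> space M. \<exists>z\<in>bulk \<kappa> \<delta> (\<kappa> / 8). \<not> m_error x z \<le> \<delta> / Im z}"
        and "x \<notin> (\<Union>z\<in>\<Gamma>'. D z)"
      then have "mean_sq_dev (X x) z \<le> \<kappa> * \<delta>\<^sup>2 / 1024" if "z \<in> \<Gamma>'" for z
        using that by (fastforce simp: D_def)
      from local_law_from_net[OF \<kappa> \<delta> N' \<Gamma>(3) this[unfolded \<Gamma>'_def]] x show False by blast
    qed
  qed
qed

lemma prob_local_law_failure_le:
  fixes \<kappa> \<theta> \<theta>' :: real
  defines "\<delta> \<equiv> real N powr (- 1 / 36)"
  assumes \<kappa>: "0 < \<kappa>" "\<kappa> < 1" and \<theta>: "\<theta> \<le> 1 / 36" "\<theta>' \<le> 1 / 36"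
    and large: "\<delta> \<le> \<kappa>" "4 \<le> sqrt (\<kappa> / 64) * (real N * \<delta> ^ 3)"
  shows "prob {x \<in> space M. \<exists>z\<in>spectral_domain \<kappa> \<theta> (\<kappa> / 8) N.
      \<not> m_error x z \<le> real N powr (- \<theta>') / Im z}
    \<le> 2304 * 1024 * B\<^sup>2 / (\<kappa> * (real N * \<delta> ^ 8))"
proof -
  have \<delta>: "0 < \<delta>" using N by (simp add: \<delta>_def)
  have \<delta>_le: "\<delta> \<le> real N powr (- \<theta>)" "\<delta> \<le> real N powr (- \<theta>')"
    unfolding \<delta>_def using N \<theta> by (intro powr_mono; simp)+
  obtain A where A: "A \<in> events" "prob A \<le> 2304 * 1024 * B\<^sup>2 / (\<kappa> * real N * \<delta> ^ 8)"
    and fails: "{x \<in> space M. \<exists>z\<in>bulk \<kappa> \<delta> (\<kappa> / 8). \<not> m_error x z \<le> \<delta> / Im z} \<subseteq> A"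
    using local_law_at_scale[OF \<kappa> \<delta> large] .
  have "\<exists>z\<in>bulk \<kappa> \<delta> (\<kappa> / 8). \<not> m_error x z \<le> \<delta> / Im z"
    if z: "z \<in> spectral_domain \<kappa> \<theta> (\<kappa> / 8) N" and bad: "\<not> m_error x z \<le> real N powr (- \<theta>') / Im z" for z x
  proof
    show bulk: "z \<in> bulk \<kappa> \<delta> (\<kappa> / 8)" using spectral_domain_subset_bulk[OF \<delta>_le(1)] z by blast
    then have "\<delta> / Im z \<le> real N powr (- \<theta>') / Im z"
      using \<delta>_le(2) \<delta> by (intro divide_right_mono) (auto simp: bulk_def)
    with bad show "\<not> m_error x z \<le> \<delta> / Im z" by linarith
  qed
  then have "prob {x \<in> space M. \<exists>z\<in>spectral_domain \<kappa> \<theta> (\<kappa> / 8) N.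
      \<not> m_error x z \<le> real N powr (- \<theta>') / Im z} \<le> prob A"
    using fails by (intro finite_measure_mono A(1)) blast
  with A(2) show ?thesis by (simp add: mult.assoc)
qed

end

lemma theta0_less_inverse_36: "theta0 d < 1 / 36"
proof -
  define p where "p = real_of_int \<lfloor>17 * real d / 16\<rfloor>"
  have "0 \<le> \<lfloor>17 * real d / 16\<rfloor>" by simp
  then have "p \<ge> 0" by (simp add: p_def)
  then have "(p / 18 - 1) / (2 * p + 4) < 1 / 36"
    by (simp add: pos_divide_less_eq)
  then show ?thesis by (simp add: theta0_def p_def Let_def)
qed

lemma torus_density_bounded_density:
  assumes "torus_density C \<rho>"
  obtains B where "bounded_density \<rho> B"
proof -
  have "isCont \<rho> x" for x
    using assms by (simp add: torus_density_def differentiable_imp_continuous_within)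
  then have cont: "continuous_on A \<rho>" for A by (simp add: continuous_at_imp_continuous_on)
  have "bounded (\<rho> ` {0..1})"
    by (intro compact_imp_bounded compact_continuous_image cont) auto
  then obtain B where B: "\<And>x. x \<in> {0..1} \<Longrightarrow> norm (\<rho> x) \<le> B"
    unfolding bounded_iff by blast
  have "bounded_density \<rho> B"
  proof
    show "\<rho> \<in> borel_measurable borel" by (intro borel_measurable_continuous_onI cont)
    show "0 \<le> B" using B[of 0] by (auto intro: order_trans[OF norm_ge_zero])
    show "\<rho> x \<le> B" if "x \<in> {0..1}" for x using B[OF that] by simp
  qed
  then show ?thesis by (rule that)
qed

theorem theorem2p5:
  fixes \<rho> :: "real \<Rightarrow> real" and C :: real
    and M :: "nat \<Rightarrow> 'a measure"
    and \<omega> :: "nat \<Rightarrow> nat \<Rightarrow> nat \<Rightarrow> 'a \<Rightarrow> real"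
    and d :: nat and \<theta> :: real
  assumes density: "torus_density C \<rho>"
    and prob: "\<And>N. N \<ge> 1 \<Longrightarrow> prob_space (M N)"
    and iid: "\<And>N. N \<ge> 1 \<Longrightarrow> iid_torus_array (M N) \<rho> N d (\<omega> N)"
    and d: "d \<ge> 18"
    and \<theta>: "0 < \<theta>" "\<theta> < theta0 d"
  shows "\<forall>\<kappa>\<in>{0<..<1}. \<exists>c>0.
    (\<lambda>N. measure (M N) {x \<in> space (M N). \<exists>z\<in>spectral_domain \<kappa> \<theta> c N.
        \<not> cmod (m_emp N d (\<lambda>j q. \<omega> N j q x) z - m_MP z) \<le> real N powr (- theta0 d) / Im z})
      \<longlonglongrightarrow> 0"
proof (intro ballI exI conjI)
  fix \<kappa> :: real assume "\<kappa> \<in> {0<..<1}"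
  then have \<kappa>: "0 < \<kappa>" "\<kappa> < 1" by auto
  then show "0 < \<kappa> / 8" by simp
  obtain B where B: "bounded_density \<rho> B" by (rule torus_density_bounded_density[OF density])
  let ?\<delta> = "\<lambda>N. real N powr (- 1 / 36)"
  let ?fail = "\<lambda>N. measure (M N) {x \<in> space (M N). \<exists>z\<in>spectral_domain \<kappa> \<theta> (\<kappa> / 8) N.
    \<not> cmod (m_emp N d (\<lambda>j q. \<omega> N j q x) z - m_MP z) \<le> real N powr (- theta0 d) / Im z}"
  have "\<forall>\<^sub>F N in sequentially. ?\<delta> N \<le> \<kappa>"
    and "\<forall>\<^sub>F N in sequentially. 4 \<le> sqrt (\<kappa> / 64) * (real N * ?\<delta> N ^ 3)"
    using \<kappa> by real_asymp+
  then have "\<forall>\<^sub>F N in sequentially. norm (?fail N) \<le> 2304 * 1024 * B\<^sup>2 / (\<kappa> * (real N * ?\<delta> N ^ 8))"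
    using eventually_ge_at_top[of 1]
  proof eventually_elim
    case (elim N)
    interpret bounded_torus_array "M N" \<rho> B N d "\<omega> N"
      using elim d prob iid B by (simp add: bounded_torus_array_def bounded_torus_array_axioms_def)
    show ?case
      using prob_local_law_failure_le[OF \<kappa>, of \<theta> "theta0 d"] elim \<theta> theta0_less_inverse_36[of d] by simp
  qed
  moreover have "(\<lambda>N. 2304 * 1024 * B\<^sup>2 / (\<kappa> * (real N * ?\<delta> N ^ 8))) \<longlonglongrightarrow> 0"
    using \<kappa> by real_asymp
  ultimately show "?fail \<longlonglongrightarrow> 0" by (rule Lim_null_comparison)
qed

end
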